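(* Work in $\mathsf{ZF}$. The following statements are equivalent: (1) The Axiom of Choice. (2) Every connected graph has a minimal dominating set. (3) Every connected bipartite graph has a maximal matching. (4) Every connected bipartite graph has a minimal edge cover.
   Context: Graphs are simple. A dominating set is a set $D$ of vertices such that every vertex is in $D$ or adjacent to a vertex of $D$; it is minimal if no proper subset is dominating. A matching is a set of pairwise non-adjacent edges; it is maximal if not properly contained in another matching. An edge cover is a set of edges such that every vertex is incident with one of them; it is minimal if no proper subset is an edge cover.
   Formalization: In (4) the connected bipartite graphs are taken without isolated vertices, which excludes exactly the one-vertex graph; that graph is connected and bipartite but has no edge cover, so (4) read literally is false. *)

theory Defs
  imports Main
begin

text \<open>
  The logic HOL has choice built in, so a theorem of ZF about the Axiom of Choice cannot be
  rendered by quantifying over HOL sets. Instead the statement is made about an arbitrary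
  first-order structure \<open>(M, \<epsilon>)\<close> that satisfies the axioms of ZF: the type \<open>'m\<close> is the universe of
  sets and \<open>mem\<close> its (arbitrary) membership relation. Separation and Replacement are first-order
  schemas, ranging over the formulas below with parameters, and not over arbitrary HOL predicates
  (the latter would make the Axiom of Choice hold in every model). In all definitions every
  quantifier over sets ranges over \<open>'m\<close>, so each notion is a first-order formula in \<open>\<epsilon>\<close>.
  Functions, natural numbers, graphs and paths are therefore those of the model.
\<close>

text \<open>Formulas of the language of set theory, with de Bruijn indices: \<open>All\<close> binds variable 0.\<close>

datatype fm = Mem nat nat | Eq nat nat | Neg fm | Conj fm fm | All fm

primrec sat :: "('m \<Rightarrow> 'm \<Rightarrow> bool) \<Rightarrow> (nat \<Rightarrow> 'm) \<Rightarrow> fm \<Rightarrow> bool" where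
  "sat mem \<rho> (Mem i j) \<longleftrightarrow> mem (\<rho> i) (\<rho> j)"
| "sat mem \<rho> (Eq i j) \<longleftrightarrow> \<rho> i = \<rho> j"
| "sat mem \<rho> (Neg \<phi>) \<longleftrightarrow> \<not> sat mem \<rho> \<phi>"
| "sat mem \<rho> (Conj \<phi> \<psi>) \<longleftrightarrow> sat mem \<rho> \<phi> \<and> sat mem \<rho> \<psi>"
| "sat mem \<rho> (All \<phi>) \<longleftrightarrow> (\<forall>x. sat mem (case_nat x \<rho>) \<phi>)"

context
  fixes mem :: "'m \<Rightarrow> 'm \<Rightarrow> bool"  (infix "\<epsilon>" 50)
begin

definition zf_subset :: "'m \<Rightarrow> 'm \<Rightarrow> bool" where
  "zf_subset A B \<longleftrightarrow> (\<forall>x. x \<epsilon> A \<longrightarrow> x \<epsilon> B)"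

definition is_empty :: "'m \<Rightarrow> bool" where
  "is_empty e \<longleftrightarrow> (\<forall>x. \<not> x \<epsilon> e)"

definition is_upair :: "'m \<Rightarrow> 'm \<Rightarrow> 'm \<Rightarrow> bool" where
  "is_upair x y p \<longleftrightarrow> (\<forall>z. z \<epsilon> p \<longleftrightarrow> z = x \<or> z = y)"

definition is_opair :: "'m \<Rightarrow> 'm \<Rightarrow> 'm \<Rightarrow> bool" where
  "is_opair x y p \<longleftrightarrow> (\<exists>a b. is_upair x x a \<and> is_upair x y b \<and> is_upair a b p)"

definition is_succ :: "'m \<Rightarrow> 'm \<Rightarrow> bool" where
  "is_succ n s \<longleftrightarrow> (\<forall>z. z \<epsilon> s \<longleftrightarrow> z \<epsilon> n \<or> z = n)"

definition is_inductive :: "'m \<Rightarrow> bool" where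
  "is_inductive I \<longleftrightarrow>
     (\<exists>e. is_empty e \<and> e \<epsilon> I) \<and> (\<forall>x. x \<epsilon> I \<longrightarrow> (\<exists>s. is_succ x s \<and> s \<epsilon> I))"

definition is_natural :: "'m \<Rightarrow> bool" where
  "is_natural n \<longleftrightarrow> (\<forall>I. is_inductive I \<longrightarrow> n \<epsilon> I)"

definition zf_app :: "'m \<Rightarrow> 'm \<Rightarrow> 'm \<Rightarrow> bool" where
  "zf_app f x y \<longleftrightarrow> (\<exists>p. is_opair x y p \<and> p \<epsilon> f)"

definition zf_function_on :: "'m \<Rightarrow> 'm \<Rightarrow> bool" where
  "zf_function_on A f \<longleftrightarrow>
     (\<forall>p. p \<epsilon> f \<longrightarrow> (\<exists>x y. x \<epsilon> A \<and> is_opair x y p)) \<and>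
     (\<forall>x. x \<epsilon> A \<longrightarrow> (\<exists>!y. zf_app f x y))"


definition ax_extensionality :: bool where
  "ax_extensionality \<longleftrightarrow> (\<forall>A B. (\<forall>x. x \<epsilon> A \<longleftrightarrow> x \<epsilon> B) \<longrightarrow> A = B)"

definition ax_foundation :: bool where
  "ax_foundation \<longleftrightarrow>
     (\<forall>A. (\<exists>x. x \<epsilon> A) \<longrightarrow> (\<exists>x. x \<epsilon> A \<and> \<not> (\<exists>y. y \<epsilon> x \<and> y \<epsilon> A)))"

definition ax_pairing :: bool where
  "ax_pairing \<longleftrightarrow> (\<forall>x y. \<exists>p. is_upair x y p)"

definition ax_union :: bool where
  "ax_union \<longleftrightarrow> (\<forall>A. \<exists>U. \<forall>x. x \<epsilon> U \<longleftrightarrow> (\<exists>B. B \<epsilon> A \<and> x \<epsilon> B))"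

definition ax_power_set :: bool where
  "ax_power_set \<longleftrightarrow> (\<forall>A. \<exists>P. \<forall>B. B \<epsilon> P \<longleftrightarrow> zf_subset B A)"

definition ax_infinity :: bool where
  "ax_infinity \<longleftrightarrow> (\<exists>I. is_inductive I)"

definition ax_separation :: bool where
  "ax_separation \<longleftrightarrow>
     (\<forall>\<phi> \<rho> A. \<exists>B. \<forall>x. x \<epsilon> B \<longleftrightarrow> x \<epsilon> A \<and> sat mem (case_nat x \<rho>) \<phi>)"

text \<open>In the replacement formula, variable 0 is the value, variable 1 the argument.\<close>

definition ax_replacement :: bool where
  "ax_replacement \<longleftrightarrow>
     (\<forall>\<phi> \<rho> A.
        (\<forall>x y y'. x \<epsilon> A \<and> sat mem (case_nat y (case_nat x \<rho>)) \<phi>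
                       \<and> sat mem (case_nat y' (case_nat x \<rho>)) \<phi> \<longrightarrow> y = y') \<longrightarrow>
        (\<exists>B. \<forall>y. y \<epsilon> B \<longleftrightarrow> (\<exists>x. x \<epsilon> A \<and> sat mem (case_nat y (case_nat x \<rho>)) \<phi>)))"

definition ZF_model :: bool where
  "ZF_model \<longleftrightarrow>
     ax_extensionality \<and> ax_foundation \<and> ax_pairing \<and> ax_union \<and> ax_power_set \<and>
     ax_infinity \<and> ax_separation \<and> ax_replacement"

definition axiom_of_choice :: bool where
  "axiom_of_choice \<longleftrightarrow>
     (\<forall>F. (\<forall>A. A \<epsilon> F \<longrightarrow> (\<exists>a. a \<epsilon> A)) \<longrightarrow>
        (\<exists>f. zf_function_on F f \<and> (\<forall>A a. A \<epsilon> F \<and> zf_app f A a \<longrightarrow> a \<epsilon> A)))"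


text \<open>
  A simple graph is given by a vertex set \<open>V\<close> and a set \<open>E\<close> of two-element subsets of \<open>V\<close>;
  \<open>v \<epsilon> e\<close> thus says that the vertex \<open>v\<close> is incident with the edge \<open>e\<close>.
\<close>

definition zf_graph :: "'m \<Rightarrow> 'm \<Rightarrow> bool" where
  "zf_graph V E \<longleftrightarrow>
     (\<forall>e. e \<epsilon> E \<longrightarrow> (\<exists>x y. x \<epsilon> V \<and> y \<epsilon> V \<and> x \<noteq> y \<and> is_upair x y e))"

definition zf_adjacent :: "'m \<Rightarrow> 'm \<Rightarrow> 'm \<Rightarrow> bool" where
  "zf_adjacent E x y \<longleftrightarrow> (\<exists>e. is_upair x y e \<and> e \<epsilon> E)"

text \<open>
  A path of length \<open>n\<close> is an injective sequence of vertices indexed by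
  \<open>n + 1 = {0, \<dots>, n}\<close>, consecutive ones being adjacent.
\<close>

definition zf_path :: "'m \<Rightarrow> 'm \<Rightarrow> 'm \<Rightarrow> 'm \<Rightarrow> 'm \<Rightarrow> 'm \<Rightarrow> bool" where
  "zf_path V E n f x y \<longleftrightarrow>
     is_natural n \<and>
     (\<exists>s. is_succ n s \<and> zf_function_on s f) \<and>
     (\<forall>i v. zf_app f i v \<longrightarrow> v \<epsilon> V) \<and>
     (\<forall>i j v. zf_app f i v \<and> zf_app f j v \<longrightarrow> i = j) \<and>
     (\<exists>z. is_empty z \<and> zf_app f z x) \<and>
     zf_app f n y \<and>
     (\<forall>i. i \<epsilon> n \<longrightarrow>
        (\<exists>j u v. is_succ i j \<and> zf_app f i u \<and> zf_app f j v \<and> zf_adjacent E u v))"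

definition zf_connected :: "'m \<Rightarrow> 'm \<Rightarrow> bool" where
  "zf_connected V E \<longleftrightarrow> (\<forall>x y. x \<epsilon> V \<and> y \<epsilon> V \<longrightarrow> (\<exists>n f. zf_path V E n f x y))"

definition zf_bipartite :: "'m \<Rightarrow> 'm \<Rightarrow> bool" where
  "zf_bipartite V E \<longleftrightarrow>
     (\<exists>A B. (\<forall>v. v \<epsilon> V \<longleftrightarrow> v \<epsilon> A \<or> v \<epsilon> B) \<and> \<not> (\<exists>v. v \<epsilon> A \<and> v \<epsilon> B) \<and>
        (\<forall>e. e \<epsilon> E \<longrightarrow> (\<exists>a b. a \<epsilon> A \<and> b \<epsilon> B \<and> is_upair a b e)))"

definition no_isolated_vertex :: "'m \<Rightarrow> 'm \<Rightarrow> bool" where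
  "no_isolated_vertex V E \<longleftrightarrow> (\<forall>v. v \<epsilon> V \<longrightarrow> (\<exists>u. u \<epsilon> V \<and> zf_adjacent E v u))"

definition dominating_set :: "'m \<Rightarrow> 'm \<Rightarrow> 'm \<Rightarrow> bool" where
  "dominating_set V E D \<longleftrightarrow>
     zf_subset D V \<and> (\<forall>v. v \<epsilon> V \<longrightarrow> v \<epsilon> D \<or> (\<exists>d. d \<epsilon> D \<and> zf_adjacent E v d))"

definition minimal_dominating_set :: "'m \<Rightarrow> 'm \<Rightarrow> 'm \<Rightarrow> bool" where
  "minimal_dominating_set V E D \<longleftrightarrow>
     dominating_set V E D \<and>
     \<not> (\<exists>D'. zf_subset D' D \<and> D' \<noteq> D \<and> dominating_set V E D')"

definition is_matching :: "'m \<Rightarrow> 'm \<Rightarrow> bool" where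
  "is_matching E M \<longleftrightarrow>
     zf_subset M E \<and>
     (\<forall>e e'. e \<epsilon> M \<and> e' \<epsilon> M \<and> e \<noteq> e' \<longrightarrow> \<not> (\<exists>v. v \<epsilon> e \<and> v \<epsilon> e'))"

definition maximal_matching :: "'m \<Rightarrow> 'm \<Rightarrow> bool" where
  "maximal_matching E M \<longleftrightarrow>
     is_matching E M \<and>
     \<not> (\<exists>M'. zf_subset M M' \<and> M \<noteq> M' \<and> is_matching E M')"

definition edge_cover :: "'m \<Rightarrow> 'm \<Rightarrow> 'm \<Rightarrow> bool" where
  "edge_cover V E C \<longleftrightarrow>
     zf_subset C E \<and> (\<forall>v. v \<epsilon> V \<longrightarrow> (\<exists>e. e \<epsilon> C \<and> v \<epsilon> e))"

definition minimal_edge_cover :: "'m \<Rightarrow> 'm \<Rightarrow> 'm \<Rightarrow> bool" where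
  "minimal_edge_cover V E C \<longleftrightarrow>
     edge_cover V E C \<and>
     \<not> (\<exists>C'. zf_subset C' C \<and> C' \<noteq> C \<and> edge_cover V E C')"

definition connected_graphs_have_minimal_dominating_sets :: bool where
  "connected_graphs_have_minimal_dominating_sets \<longleftrightarrow>
     (\<forall>V E. zf_graph V E \<and> zf_connected V E \<longrightarrow> (\<exists>D. minimal_dominating_set V E D))"

definition connected_bipartite_graphs_have_maximal_matchings :: bool where
  "connected_bipartite_graphs_have_maximal_matchings \<longleftrightarrow>
     (\<forall>V E. zf_graph V E \<and> zf_connected V E \<and> zf_bipartite V E \<longrightarrow>
        (\<exists>M. maximal_matching E M))"

text \<open>
  The graph with one vertex and no edge is connected and bipartite but has no edge cover at all,
  so it has to be excluded; it is the only connected graph with an isolated vertex.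
\<close>

definition connected_bipartite_graphs_have_minimal_edge_covers :: bool where
  "connected_bipartite_graphs_have_minimal_edge_covers \<longleftrightarrow>
     (\<forall>V E. zf_graph V E \<and> zf_connected V E \<and> zf_bipartite V E \<and> no_isolated_vertex V E \<longrightarrow>
        (\<exists>C. minimal_edge_cover V E C))"

end

end

theory Submission
  imports Defs
begin

text \<open>
  Choice gives maximal independent sets by Zermelo's tower argument, carried out inside the model.
  Applied to the graph it gives a minimal dominating set; applied to the conflict relation of edges,
  a maximal matching, from which a minimal edge cover is built.

  Conversely, for a family \<open>F\<close> of nonempty sets consider a graph in which a hub is joined to all
  pairs \<open>(A, a)\<close> with \<open>a \<epsilon> A \<epsilon> F\<close>, and the pairs over \<open>A\<close> are all joined to a set of outer vertices
  \<open>(A, s)\<close>, \<open>s \<epsilon> G A\<close>. Taking \<open>A\<close>, a singleton or the power set of \<open>A\<close> for \<open>G A\<close>, a minimal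
  dominating set, a maximal matching or a minimal edge cover, respectively, picks an element of \<open>A\<close>.

  Separation holds in the model for first-order formulas only, so every set formed in the argument
  has to be definable with parameters.
\<close>

section \<open>Definable predicates and terms\<close>

text \<open>The hub is there for connectedness only, and being shared by all \<open>A\<close> it
  could disturb the selection everywhere at once. It does not reach the outer vertices: these are
  dominated, matched or covered only from within the block of their own \<open>A\<close>. For each
  \<open>A\<close> the structure found in the graph has to single out exactly one element,
  definably, since picking one of several would use choice again; this is what shapes
  \<open>G A\<close>. For edge covers the difficulty is that a minimal cover is a union of stars
  whose centres may lie on either side. Cantor's theorem on the power set locates, definably in
  \<open>A\<close>, an outer vertex that is a leaf, and its only neighbour is the selected element.

  Paths have lengths in the naturals of the model, which may be nonstandard. Every vertex is within
  distance two of the hub, so all paths needed come from HOL lists.\<close>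

primrec rename :: "(nat \<Rightarrow> nat) \<Rightarrow> fm \<Rightarrow> fm" where
  "rename k (Mem i j) = Mem (k i) (k j)"
| "rename k (Eq i j) = Eq (k i) (k j)"
| "rename k (Neg \<phi>) = Neg (rename k \<phi>)"
| "rename k (Conj \<phi> \<psi>) = Conj (rename k \<phi>) (rename k \<psi>)"
| "rename k (All \<phi>) = All (rename (case_nat 0 (\<lambda>i. Suc (k i))) \<phi>)"

lemma sat_rename: "sat mem \<rho> (rename k \<phi>) \<longleftrightarrow> sat mem (\<lambda>i. \<rho> (k i)) \<phi>"
proof (induction \<phi> arbitrary: k \<rho>)
  case (All \<phi>)
  have "(\<lambda>i. case_nat x \<rho> (case_nat 0 (\<lambda>i. Suc (k i)) i)) = case_nat x (\<lambda>i. \<rho> (k i))" for x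
    by (auto simp: fun_eq_iff split: nat.split)
  then show ?case by (simp add: All)
qed auto

locale zf_universe =
  fixes mem :: "'m \<Rightarrow> 'm \<Rightarrow> bool"  (infix "\<epsilon>" 50)
  assumes zf: "ZF_model mem"
begin

text \<open>
  A slot of a formula is filled either from the environment (\<open>Inl\<close>) or with a fixed
  parameter (\<open>Inr\<close>), so definability is with parameters.
\<close>

definition definable :: "((nat \<Rightarrow> 'm) \<Rightarrow> bool) \<Rightarrow> bool" where
  "definable P \<longleftrightarrow> (\<exists>\<phi> h. \<forall>\<rho>. P \<rho> \<longleftrightarrow> sat mem (\<lambda>i. case_sum \<rho> (\<lambda>c. c) (h i)) \<phi>)"

text \<open>The language has no function symbols, so a term counts as definable when its graph is;
  slot 0 holds the value.\<close>

definition definable_term :: "((nat \<Rightarrow> 'm) \<Rightarrow> 'm) \<Rightarrow> bool" where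
  "definable_term t \<longleftrightarrow> definable (\<lambda>\<rho>. \<rho> 0 = t (\<lambda>i. \<rho> (Suc i)))"

lemma definable_shift:
  assumes "definable P"
  shows "definable (\<lambda>\<rho>. P (\<lambda>i. \<rho> (k i)))"
proof -
  obtain \<phi> h where P: "\<And>\<rho>. P \<rho> \<longleftrightarrow> sat mem (\<lambda>i. case_sum \<rho> (\<lambda>c. c) (h i)) \<phi>"
    using assms unfolding definable_def by blast
  have "case_sum (\<lambda>i. \<rho> (k i)) (\<lambda>c. c) s = case_sum \<rho> (\<lambda>c. c) (map_sum k (\<lambda>c. c) s)"
    for \<rho> :: "nat \<Rightarrow> 'm" and s by (cases s) auto
  then show ?thesis
    unfolding definable_def P by (intro exI[of _ \<phi>] exI[of _ "\<lambda>i. map_sum k (\<lambda>c. c) (h i)"]) simp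
qed

lemma definable_Neg:
  assumes "definable P"
  shows "definable (\<lambda>\<rho>. \<not> P \<rho>)"
proof -
  obtain \<phi> h where "\<And>\<rho>. P \<rho> \<longleftrightarrow> sat mem (\<lambda>i. case_sum \<rho> (\<lambda>c. c) (h i)) \<phi>"
    using assms unfolding definable_def by blast
  then show ?thesis
    unfolding definable_def by (intro exI[of _ "Neg \<phi>"] exI[of _ h]) simp
qed

lemma definable_Conj:
  assumes "definable P" "definable Q"
  shows "definable (\<lambda>\<rho>. P \<rho> \<and> Q \<rho>)"
proof -
  obtain \<phi> h where P: "\<And>\<rho>. P \<rho> \<longleftrightarrow> sat mem (\<lambda>i. case_sum \<rho> (\<lambda>c. c) (h i)) \<phi>"
    using assms unfolding definable_def by blast
  obtain \<psi> g where Q: "\<And>\<rho>. Q \<rho> \<longleftrightarrow> sat mem (\<lambda>i. case_sum \<rho> (\<lambda>c. c) (g i)) \<psi>"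
    using assms unfolding definable_def by blast
  \<comment> \<open>The two formulas get disjoint slots, even ones for \<open>\<phi>\<close> and odd
    ones for \<open>\<psi>\<close>, so their assignments can be merged.\<close>
  let ?h = "\<lambda>i. if even i then h (i div 2) else g (i div 2)"
  show ?thesis
    unfolding definable_def P Q
    by (intro exI[of _ "Conj (rename (\<lambda>i. 2 * i) \<phi>) (rename (\<lambda>i. 2 * i + 1) \<psi>)"] exI[of _ ?h])
      (simp add: sat_rename)
qed

text \<open>Separates the slots filled with variable 0 from the others.\<close>

lemma definable_bind:
  assumes "definable P"
  obtains \<phi> h where "\<And>x \<rho>. P (case_nat x \<rho>) \<longleftrightarrow>
    sat mem (case_nat x (\<lambda>i. case_sum \<rho> (\<lambda>c. c) (h i))) \<phi>"
proof -
  obtain \<phi> h where P: "\<And>\<rho>. P \<rho> \<longleftrightarrow> sat mem (\<lambda>i. case_sum \<rho> (\<lambda>c. c) (h i)) \<phi>"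
    using assms unfolding definable_def by blast
  \<comment> \<open>All slots filled with variable 0 collapse to index 0. The shift
    \<open>n - 1\<close> is then consulted only for \<open>n > 0\<close>.\<close>
  let ?k = "\<lambda>i. if h i = Inl 0 then 0 else Suc i"
  let ?h = "\<lambda>i. map_sum (\<lambda>n. n - 1) (\<lambda>c. c) (h i)"
  have "case_sum (case_nat x \<rho>) (\<lambda>c. c) (h i) =
      case_nat x (\<lambda>i. case_sum \<rho> (\<lambda>c. c) (?h i)) (?k i)" for x \<rho> i
    by (cases "h i") (auto split: nat.split)
  then have "P (case_nat x \<rho>) \<longleftrightarrow>
      sat mem (case_nat x (\<lambda>i. case_sum \<rho> (\<lambda>c. c) (?h i))) (rename ?k \<phi>)" for x \<rho>
    unfolding P sat_rename by presburger
  then show thesis by (rule that)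
qed

text \<open>The bound element is an argument of \<open>P\<close>, so that \<open>intro\<close>
  applies to quantified statements as they are written.\<close>

lemma definable_All:
  assumes "definable (\<lambda>\<rho>. P (\<lambda>i. \<rho> (Suc i)) (\<rho> 0))"
  shows "definable (\<lambda>\<rho>. \<forall>x. P \<rho> x)"
proof -
  obtain \<phi> h where "\<And>x \<rho>. P (\<lambda>i. case_nat x \<rho> (Suc i)) (case_nat x \<rho> 0) \<longleftrightarrow>
      sat mem (case_nat x (\<lambda>i. case_sum \<rho> (\<lambda>c. c) (h i))) \<phi>"
    using definable_bind[OF assms] by metis
  then show ?thesis
    unfolding definable_def by (intro exI[of _ "All \<phi>"] exI[of _ h]) auto
qed

lemma definable_Disj:
  assumes "definable P" "definable Q"
  shows "definable (\<lambda>\<rho>. P \<rho> \<or> Q \<rho>)"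
  using definable_Neg[OF definable_Conj[OF definable_Neg[OF assms(1)] definable_Neg[OF assms(2)]]]
  by simp

lemma definable_Imp:
  assumes "definable P" "definable Q"
  shows "definable (\<lambda>\<rho>. P \<rho> \<longrightarrow> Q \<rho>)"
  unfolding imp_conv_disj by (intro definable_Disj definable_Neg assms)

lemma definable_Iff:
  assumes "definable P" "definable Q"
  shows "definable (\<lambda>\<rho>. P \<rho> \<longleftrightarrow> Q \<rho>)"
  unfolding iff_conv_conj_imp by (intro definable_Conj definable_Imp assms)

lemma definable_Ex:
  assumes "definable (\<lambda>\<rho>. P (\<lambda>i. \<rho> (Suc i)) (\<rho> 0))"
  shows "definable (\<lambda>\<rho>. \<exists>x. P \<rho> x)"
  using definable_Neg[OF definable_All[of "\<lambda>\<rho> x. \<not> P \<rho> x", OF definable_Neg[OF assms]]] by simp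

lemma definable_term_var: "definable_term (\<lambda>\<rho>. \<rho> i)"
  unfolding definable_term_def definable_def
  by (intro exI[of _ "Eq 0 1"] exI[of _ "case_nat (Inl 0) (\<lambda>_. Inl (Suc i))"]) simp

lemma definable_term_const: "definable_term (\<lambda>\<rho>. c)"
  unfolding definable_term_def definable_def
  by (intro exI[of _ "Eq 0 1"] exI[of _ "case_nat (Inl 0) (\<lambda>_. Inr c)"]) simp

lemma definable_term_shift:
  assumes "definable_term t"
  shows "definable_term (\<lambda>\<rho>. t (\<lambda>i. \<rho> (k i)))"
  using definable_shift[OF assms[unfolded definable_term_def], of "case_nat 0 (\<lambda>i. Suc (k i))"]
  unfolding definable_term_def by simp

text \<open>The usual elimination of a defined function symbol: its value is named by a quantified
  variable satisfying the graph.\<close>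

lemma definable_subst:
  assumes "definable_term t" "definable (\<lambda>\<rho>. Q (\<lambda>i. \<rho> (Suc i)) (\<rho> 0))"
  shows "definable (\<lambda>\<rho>. Q \<rho> (t \<rho>))"
proof -
  have "definable (\<lambda>\<rho>. \<exists>x. x = t \<rho> \<and> Q \<rho> x)"
    by (intro definable_Ex definable_Conj) (use assms in \<open>auto simp: definable_term_def\<close>)
  then show ?thesis by simp
qed

lemma definable_rel:
  assumes R: "definable (\<lambda>\<rho>. R (\<rho> 0) (\<rho> 1))" and t: "definable_term t" and u: "definable_term u"
  shows "definable (\<lambda>\<rho>. R (t \<rho>) (u \<rho>))"
proof -
  have "definable (\<lambda>\<rho>. R (\<rho> 0) (\<rho> (Suc 0)))" using R by simp
  from definable_shift[OF this, of "case_nat 1 (\<lambda>_. 0)"]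
  have "definable (\<lambda>\<rho>. R (\<rho> (Suc 0)) (\<rho> 0))" by simp
  from definable_subst[of "\<lambda>\<rho>. u (\<lambda>i. \<rho> (Suc i))" "\<lambda>\<rho> y. R (\<rho> 0) y",
      OF definable_term_shift[OF u] this]
  show ?thesis by (rule definable_subst[OF t])
qed

lemma definable_Mem:
  assumes "definable_term t" "definable_term u"
  shows "definable (\<lambda>\<rho>. t \<rho> \<epsilon> u \<rho>)"
proof (rule definable_rel[OF _ assms])
  show "definable (\<lambda>\<rho>. \<rho> 0 \<epsilon> \<rho> 1)"
    unfolding definable_def by (intro exI[of _ "Mem 0 1"] exI[of _ Inl]) simp
qed

lemma definable_Eq:
  assumes "definable_term t" "definable_term u"
  shows "definable (\<lambda>\<rho>. t \<rho> = u \<rho>)"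
proof (rule definable_rel[OF _ assms])
  show "definable (\<lambda>\<rho>. \<rho> 0 = \<rho> 1)"
    unfolding definable_def by (intro exI[of _ "Eq 0 1"] exI[of _ Inl]) simp
qed

lemma definable_term_app:
  assumes c: "definable_term (\<lambda>\<rho>. c (\<rho> 0))" and t: "definable_term t"
  shows "definable_term (\<lambda>\<rho>. c (t \<rho>))"
proof -
  have "definable (\<lambda>\<rho>. \<rho> 0 = c (\<rho> 1))" using c by (simp add: definable_term_def)
  then show ?thesis
    unfolding definable_term_def
    by (rule definable_rel[OF _ definable_term_var definable_term_shift[OF t]])
qed

lemma definable_term_app2:
  assumes c: "definable (\<lambda>\<rho>. \<rho> 0 = c (\<rho> 1) (\<rho> 2))"
    and t: "definable_term t" and u: "definable_term u"
  shows "definable_term (\<lambda>\<rho>. c (t \<rho>) (u \<rho>))"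
proof -
  \<comment> \<open>\<open>definable_subst\<close> fills slot 0, so reversing the slots makes the
    arguments available last one first, with the value in slot 2.\<close>
  have c': "definable (\<lambda>\<rho>. \<rho> (Suc (Suc 0)) = c (\<rho> (Suc 0)) (\<rho> 0))"
    using definable_shift[OF c, of "\<lambda>i. 2 - i"] by (simp add: numeral_2_eq_2)
  have "definable (\<lambda>\<rho>. \<rho> (Suc 0) = c (\<rho> 0) (u (\<lambda>i. \<rho> (Suc (Suc i)))))"
    by (rule definable_subst[of "\<lambda>\<rho>. u (\<lambda>i. \<rho> (Suc (Suc i)))" "\<lambda>\<rho> y. \<rho> (Suc 0) = c (\<rho> 0) y",
          OF definable_term_shift[OF u] c'])
  from definable_subst[of "\<lambda>\<rho>. t (\<lambda>i. \<rho> (Suc i))" "\<lambda>\<rho> x. \<rho> 0 = c x (u (\<lambda>i. \<rho> (Suc i)))",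
      OF definable_term_shift[OF t] this]
  show ?thesis unfolding definable_term_def .
qed

lemmas definable_logic = definable_All definable_Ex definable_Iff definable_Imp definable_Disj
  definable_Conj definable_Neg definable_Mem definable_Eq definable_term_var definable_term_const


section \<open>Sets of the model\<close>

lemma extensionality: "(\<And>x. x \<epsilon> A \<longleftrightarrow> x \<epsilon> B) \<Longrightarrow> A = B"
  using zf unfolding ZF_model_def ax_extensionality_def by blast

text \<open>Foundation for the singleton of \<open>x\<close>. It serves to tell the numerals
  apart.\<close>

lemma mem_irrefl: "\<not> x \<epsilon> x"
proof -
  obtain p where "is_upair mem x x p"
    using zf unfolding ZF_model_def ax_pairing_def by blast
  then have p: "\<And>z. z \<epsilon> p \<longleftrightarrow> z = x" by (simp add: is_upair_def)
  moreover have "(\<exists>x. x \<epsilon> p) \<longrightarrow> (\<exists>x. x \<epsilon> p \<and> \<not> (\<exists>y. y \<epsilon> x \<and> y \<epsilon> p))"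
    using zf unfolding ZF_model_def ax_foundation_def by blast
  ultimately show ?thesis by auto
qed

text \<open>\<open>P\<close> may be any HOL predicate, but its set is guaranteed to exist only for
  definable \<open>P\<close>.\<close>

definition sep :: "'m \<Rightarrow> ('m \<Rightarrow> bool) \<Rightarrow> 'm" where
  "sep A P = (THE B. \<forall>x. x \<epsilon> B \<longleftrightarrow> x \<epsilon> A \<and> P x)"

lemma mem_sep_env:
  assumes "definable (\<lambda>\<rho>. P (\<lambda>i. \<rho> (Suc i)) (\<rho> 0))"
  shows "x \<epsilon> sep A (P \<rho>) \<longleftrightarrow> x \<epsilon> A \<and> P \<rho> x"
proof -
  obtain \<phi> h where P: "\<And>x \<rho>. P (\<lambda>i. case_nat x \<rho> (Suc i)) (case_nat x \<rho> 0) \<longleftrightarrow>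
      sat mem (case_nat x (\<lambda>i. case_sum \<rho> (\<lambda>c. c) (h i))) \<phi>"
    using definable_bind[OF assms] by metis
  have "\<exists>B. \<forall>x. x \<epsilon> B \<longleftrightarrow> x \<epsilon> A \<and> sat mem (case_nat x (\<lambda>i. case_sum \<rho> (\<lambda>c. c) (h i))) \<phi>"
    using zf unfolding ZF_model_def ax_separation_def by blast
  then obtain B where B: "\<forall>x. x \<epsilon> B \<longleftrightarrow> x \<epsilon> A \<and> P \<rho> x"
    using P by auto
  have "\<forall>x. x \<epsilon> sep A (P \<rho>) \<longleftrightarrow> x \<epsilon> A \<and> P \<rho> x"
    unfolding sep_def by (rule theI[of _ B]) (use B in \<open>auto intro: extensionality\<close>)
  then show ?thesis by blast
qed

lemma mem_sep: "definable (\<lambda>\<rho>. P (\<rho> 0)) \<Longrightarrow> x \<epsilon> sep A P \<longleftrightarrow> x \<epsilon> A \<and> P x"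
  by (rule mem_sep_env[of "\<lambda>_. P"])

text \<open>By extensionality, being this set is a first-order statement about its elements, so sets
  with varying parameters can be used in further instances of Separation.\<close>

lemma definable_sep:
  assumes A: "definable_term A" and P: "definable (\<lambda>\<rho>. P (\<lambda>i. \<rho> (Suc i)) (\<rho> 0))"
  shows "definable_term (\<lambda>\<rho>. sep (A \<rho>) (P \<rho>))"
proof -
  have eq: "B = sep (A \<rho>) (P \<rho>) \<longleftrightarrow> (\<forall>x. x \<epsilon> B \<longleftrightarrow> x \<epsilon> A \<rho> \<and> P \<rho> x)" for B \<rho>
    using mem_sep_env[OF P] extensionality by blast
  have "definable (\<lambda>\<rho>. P (\<lambda>i. \<rho> (Suc (Suc i))) (\<rho> 0))"
    using definable_shift[OF P, of "case_nat 0 (\<lambda>i. Suc (Suc i))"] by simp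
  then show ?thesis
    unfolding definable_term_def eq
    by (intro definable_logic definable_term_shift[OF A])
qed

section \<open>Basic set operations and their first-order graphs\<close>

definition empt :: 'm where
  "empt = (THE e. is_empty mem e)"

definition pair :: "'m \<Rightarrow> 'm \<Rightarrow> 'm" where
  "pair a b = (THE p. is_upair mem a b p)"

definition opair :: "'m \<Rightarrow> 'm \<Rightarrow> 'm" where
  "opair a b = pair (pair a a) (pair a b)"

definition Uni :: "'m \<Rightarrow> 'm" where
  "Uni A = (THE U. \<forall>x. x \<epsilon> U \<longleftrightarrow> (\<exists>B. B \<epsilon> A \<and> x \<epsilon> B))"

definition Pw :: "'m \<Rightarrow> 'm" where
  "Pw A = (THE P. \<forall>B. B \<epsilon> P \<longleftrightarrow> zf_subset mem B A)"

definition succ :: "'m \<Rightarrow> 'm" where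
  "succ n = Uni (pair n (pair n n))"

lemma mem_empt: "\<not> x \<epsilon> empt"
proof -
  have def: "definable (\<lambda>\<rho>. \<not> \<rho> 0 = \<rho> 0)" by (intro definable_logic)
  have e: "is_empty mem (sep A (\<lambda>x. x \<noteq> x))" for A
    using mem_sep[OF def] by (simp add: is_empty_def)
  have "is_empty mem empt"
    unfolding empt_def
    by (rule theI[of _ "sep undefined (\<lambda>x. x \<noteq> x)"]) (use e in \<open>auto simp: is_empty_def intro: extensionality\<close>)
  then show ?thesis by (simp add: is_empty_def)
qed

lemma mem_pair: "z \<epsilon> pair a b \<longleftrightarrow> z = a \<or> z = b"
proof -
  obtain p where p: "is_upair mem a b p"
    using zf unfolding ZF_model_def ax_pairing_def by blast
  have "is_upair mem a b (pair a b)"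
    unfolding pair_def by (rule theI[of _ p]) (use p in \<open>auto simp: is_upair_def intro: extensionality\<close>)
  then show ?thesis by (simp add: is_upair_def)
qed

lemma mem_Uni: "x \<epsilon> Uni A \<longleftrightarrow> (\<exists>B. B \<epsilon> A \<and> x \<epsilon> B)"
proof -
  obtain U where U: "\<forall>x. x \<epsilon> U \<longleftrightarrow> (\<exists>B. B \<epsilon> A \<and> x \<epsilon> B)"
    using zf unfolding ZF_model_def ax_union_def by blast
  have "\<forall>x. x \<epsilon> Uni A \<longleftrightarrow> (\<exists>B. B \<epsilon> A \<and> x \<epsilon> B)"
    unfolding Uni_def by (rule theI[of _ U]) (use U in \<open>auto intro: extensionality\<close>)
  then show ?thesis by blast
qed

lemma mem_Uni_pair: "x \<epsilon> Uni (pair A B) \<longleftrightarrow> x \<epsilon> A \<or> x \<epsilon> B"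
  by (auto simp: mem_Uni mem_pair)

lemma mem_Pw: "B \<epsilon> Pw A \<longleftrightarrow> (\<forall>x. x \<epsilon> B \<longrightarrow> x \<epsilon> A)"
proof -
  obtain P where P: "\<forall>B. B \<epsilon> P \<longleftrightarrow> zf_subset mem B A"
    using zf unfolding ZF_model_def ax_power_set_def by blast
  have "\<forall>B. B \<epsilon> Pw A \<longleftrightarrow> zf_subset mem B A"
    unfolding Pw_def by (rule theI[of _ P]) (use P in \<open>auto intro: extensionality\<close>)
  then show ?thesis by (simp add: zf_subset_def)
qed

lemma mem_succ: "z \<epsilon> succ n \<longleftrightarrow> z \<epsilon> n \<or> z = n"
  by (simp add: succ_def mem_Uni_pair mem_pair)

lemma is_empty_iff: "is_empty mem e \<longleftrightarrow> e = empt"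
  using mem_empt extensionality unfolding is_empty_def by blast

lemma is_upair_iff: "is_upair mem a b p \<longleftrightarrow> p = pair a b"
  using mem_pair extensionality unfolding is_upair_def by blast

lemma is_opair_iff: "is_opair mem a b p \<longleftrightarrow> p = opair a b"
  by (simp add: is_opair_def is_upair_iff opair_def)

lemma is_succ_iff: "is_succ mem n s \<longleftrightarrow> s = succ n"
  using mem_succ extensionality unfolding is_succ_def by blast

lemma zf_app_iff: "zf_app mem f x y \<longleftrightarrow> opair x y \<epsilon> f"
  by (simp add: zf_app_def is_opair_iff)

lemma zf_adjacent_iff: "zf_adjacent mem E x y \<longleftrightarrow> pair x y \<epsilon> E"
  by (simp add: zf_adjacent_def is_upair_iff)

lemma pair_eq_iff: "pair a b = pair c d \<longleftrightarrow> a = c \<and> b = d \<or> a = d \<and> b = c"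
proof
  assume "pair a b = pair c d"
  then have "\<forall>z. z = a \<or> z = b \<longleftrightarrow> z = c \<or> z = d" by (simp flip: mem_pair)
  then show "a = c \<and> b = d \<or> a = d \<and> b = c" by metis
qed (auto intro: extensionality simp: mem_pair)

lemma opair_inject: "opair a b = opair c d \<longleftrightarrow> a = c \<and> b = d"
  by (auto simp: opair_def pair_eq_iff)

text \<open>A Kuratowski pair is a set of subsets of \<open>A \<union> B\<close>. The double power
  set is the ambient set from which sets of pairs are separated.\<close>

lemma opair_mem_Pw:
  assumes "a \<epsilon> A" "b \<epsilon> B"
  shows "opair a b \<epsilon> Pw (Pw (Uni (pair A B)))"
proof -
  have U: "a \<epsilon> Uni (pair A B)" "b \<epsilon> Uni (pair A B)"
    unfolding mem_Uni_pair using assms by auto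
  have "pair x y \<epsilon> Pw D" if "x \<epsilon> D" "y \<epsilon> D" for x y D
    using that by (auto simp: mem_Pw mem_pair)
  then show ?thesis using U by (simp add: opair_def)
qed

lemma definable_pair:
  "definable_term t \<Longrightarrow> definable_term u \<Longrightarrow> definable_term (\<lambda>\<rho>. pair (t \<rho>) (u \<rho>))"
proof (rule definable_term_app2[where c = pair])
  have eq: "x = pair a b \<longleftrightarrow> (\<forall>z. z \<epsilon> x \<longleftrightarrow> z = a \<or> z = b)" for x a b
    by (simp add: is_upair_def flip: is_upair_iff)
  show "definable (\<lambda>\<rho>. \<rho> 0 = pair (\<rho> 1) (\<rho> 2))"
    unfolding eq by (intro definable_logic)
qed

lemma definable_opair:
  "definable_term t \<Longrightarrow> definable_term u \<Longrightarrow> definable_term (\<lambda>\<rho>. opair (t \<rho>) (u \<rho>))"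
  unfolding opair_def by (intro definable_pair)

lemma definable_Uni: "definable_term t \<Longrightarrow> definable_term (\<lambda>\<rho>. Uni (t \<rho>))"
proof (rule definable_term_app[where c = Uni])
  have eq: "x = Uni a \<longleftrightarrow> (\<forall>z. z \<epsilon> x \<longleftrightarrow> (\<exists>B. B \<epsilon> a \<and> z \<epsilon> B))" for x a
    by (rule iffI) (simp add: mem_Uni, rule extensionality, simp add: mem_Uni)
  show "definable_term (\<lambda>\<rho>. Uni (\<rho> 0))"
    unfolding definable_term_def eq by (intro definable_logic)
qed

lemma definable_Pw: "definable_term t \<Longrightarrow> definable_term (\<lambda>\<rho>. Pw (t \<rho>))"
proof (rule definable_term_app[where c = Pw])
  have eq: "x = Pw a \<longleftrightarrow> (\<forall>B. B \<epsilon> x \<longleftrightarrow> (\<forall>z. z \<epsilon> B \<longrightarrow> z \<epsilon> a))" for x a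
    by (rule iffI) (simp add: mem_Pw, rule extensionality, simp add: mem_Pw)
  show "definable_term (\<lambda>\<rho>. Pw (\<rho> 0))"
    unfolding definable_term_def eq by (intro definable_logic)
qed

lemmas definable = definable_logic definable_pair definable_opair definable_Uni definable_Pw


section \<open>Choice functions\<close>

text \<open>Uniqueness makes the relation itself a choice function, and definability makes it a set.
  All three converse directions end here.\<close>

lemma choice_from_relation:
  assumes C: "definable (\<lambda>\<rho>. C (\<rho> 0) (\<rho> 1))"
    and ex1: "\<And>A. A \<epsilon> F \<Longrightarrow> \<exists>!a. a \<epsilon> A \<and> C A a"
  shows "\<exists>f. zf_function_on mem F f \<and> (\<forall>A a. A \<epsilon> F \<and> zf_app mem f A a \<longrightarrow> a \<epsilon> A)"
proof -
  let ?P = "\<lambda>p. \<exists>A a. A \<epsilon> F \<and> a \<epsilon> A \<and> C A a \<and> p = opair A a"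
  let ?f = "sep (Pw (Pw (Uni (pair F (Uni F))))) ?P"
  have "definable (\<lambda>\<rho>. ?P (\<rho> 0))"
    by (intro definable definable_rel[OF C])
  then have f: "p \<epsilon> ?f \<longleftrightarrow> ?P p" for p
    by (subst mem_sep) (auto intro!: opair_mem_Pw simp: mem_Uni)
  have app: "zf_app mem ?f A a \<longleftrightarrow> A \<epsilon> F \<and> a \<epsilon> A \<and> C A a" for A a
    unfolding zf_app_iff f by (auto simp: opair_inject)
  have "zf_function_on mem F ?f"
    unfolding zf_function_on_def app is_opair_iff f using ex1 by blast
  then show ?thesis using app by blast
qed

text \<open>The choice function given by the axiom is a set of pairs; \<open>c\<close> is a total
  HOL function agreeing with it that can occur as a term in Separation.\<close>

lemma choice_on_subsets:
  assumes "axiom_of_choice mem"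
  obtains c where "\<And>S. \<forall>x. x \<epsilon> S \<longrightarrow> x \<epsilon> X \<Longrightarrow> \<exists>x. x \<epsilon> S \<Longrightarrow> c S \<epsilon> S"
    "definable_term (\<lambda>\<rho>. c (\<rho> 0))"
proof -
  let ?F = "sep (Pw X) (\<lambda>S. \<exists>x. x \<epsilon> S)"
  have F: "S \<epsilon> ?F \<longleftrightarrow> (\<forall>x. x \<epsilon> S \<longrightarrow> x \<epsilon> X) \<and> (\<exists>x. x \<epsilon> S)" for S
    by (subst mem_sep) (auto intro!: definable simp: mem_Pw)
  obtain f where f: "zf_function_on mem ?F f" "\<And>A a. A \<epsilon> ?F \<Longrightarrow> zf_app mem f A a \<Longrightarrow> a \<epsilon> A"
    using assms F unfolding axiom_of_choice_def by blast
  \<comment> \<open>The default \<open>empt\<close> makes the value first-order describable even at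
    arguments outside the domain of \<open>f\<close>.\<close>
  define c where "c S = (if \<exists>!y. opair S y \<epsilon> f then THE y. opair S y \<epsilon> f else empt)" for S
  have c_iff: "x = c S \<longleftrightarrow> (opair S x \<epsilon> f \<and> (\<forall>y. opair S y \<epsilon> f \<longrightarrow> y = x)) \<or>
      ((\<forall>y. opair S y \<epsilon> f \<longrightarrow> (\<exists>z. opair S z \<epsilon> f \<and> z \<noteq> y)) \<and> x = empt)" for x S
  proof (cases "\<exists>!y. opair S y \<epsilon> f")
    case True
    then obtain y where y: "opair S y \<epsilon> f" "\<And>z. opair S z \<epsilon> f \<Longrightarrow> z = y" by blast
    then have "c S = y" unfolding c_def if_P[OF True] by (rule the_equality)
    then show ?thesis using y by blast
  next
    case False
    then have "c S = empt" by (simp only: c_def if_False)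
    moreover have "\<not> (opair S y \<epsilon> f \<and> (\<forall>z. opair S z \<epsilon> f \<longrightarrow> z = y))" for y
      using False by blast
    ultimately show ?thesis by metis
  qed
  show thesis
  proof
    fix S assume S: "\<forall>x. x \<epsilon> S \<longrightarrow> x \<epsilon> X" "\<exists>x. x \<epsilon> S"
    then have "\<exists>!y. opair S y \<epsilon> f"
      using f(1) F unfolding zf_function_on_def zf_app_iff by blast
    then have "zf_app mem f S (c S)"
      unfolding c_def zf_app_iff by (simp only: if_True) (rule theI')
    moreover have "S \<epsilon> ?F" unfolding F using S by blast
    ultimately show "c S \<epsilon> S" by (rule f(2)[rotated])
  next
    show "definable_term (\<lambda>\<rho>. c (\<rho> 0))"
      unfolding definable_term_def c_iff by (intro definable)
  qed
qed


section \<open>Maximal independent sets from choice\<close>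

definition independent :: "('m \<Rightarrow> 'm \<Rightarrow> bool) \<Rightarrow> 'm \<Rightarrow> bool" where
  "independent R W \<longleftrightarrow> (\<forall>x y. x \<epsilon> W \<and> y \<epsilon> W \<longrightarrow> \<not> R x y)"

text \<open>
  Zermelo's tower: the least family of subsets of \<open>X\<close> that is closed under adding the chosen
  compatible element and under unions is a chain, and its union is the desired set.
\<close>

lemma maximal_independent_exists:
  assumes AC: "axiom_of_choice mem"
    and R: "definable (\<lambda>\<rho>. R (\<rho> 0) (\<rho> 1))"
    and sym: "\<And>x y. R x y \<Longrightarrow> R y x" and irrefl: "\<And>x. \<not> R x x"
  obtains W where "\<And>x. x \<epsilon> W \<Longrightarrow> x \<epsilon> X" "independent R W"
    "\<And>x. x \<epsilon> X \<Longrightarrow> \<not> x \<epsilon> W \<Longrightarrow> \<exists>y. y \<epsilon> W \<and> R x y"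
proof -
  obtain c where c: "\<And>S. \<forall>x. x \<epsilon> S \<longrightarrow> x \<epsilon> X \<Longrightarrow> \<exists>x. x \<epsilon> S \<Longrightarrow> c S \<epsilon> S"
    and cdef: "definable_term (\<lambda>\<rho>. c (\<rho> 0))"
    using choice_on_subsets[OF AC] by blast
  define cand where "cand T = sep X (\<lambda>x. \<not> x \<epsilon> T \<and> (\<forall>y. y \<epsilon> T \<longrightarrow> \<not> R x y))" for T
  have mem_cand: "x \<epsilon> cand T \<longleftrightarrow> x \<epsilon> X \<and> \<not> x \<epsilon> T \<and> (\<forall>y. y \<epsilon> T \<longrightarrow> \<not> R x y)" for x T
    unfolding cand_def by (rule mem_sep) (intro definable definable_rel[OF R])
  have "definable_term (\<lambda>\<rho>. cand (\<rho> 0))"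
    unfolding cand_def by (intro definable definable_sep definable_rel[OF R])
  note def_cand = definable_term_app[OF this]
  \<comment> \<open>If there is no candidate, the value of \<open>c\<close> is arbitrary; the clause
    \<open>x \<epsilon> cand T\<close> then prevents any addition.\<close>
  define nxt where "nxt T = sep X (\<lambda>x. x \<epsilon> T \<or> x = c (cand T) \<and> x \<epsilon> cand T)" for T
  have mem_nxt: "x \<epsilon> nxt T \<longleftrightarrow> x \<epsilon> X \<and> (x \<epsilon> T \<or> x = c (cand T) \<and> x \<epsilon> cand T)" for x T
    unfolding nxt_def
    by (rule mem_sep) (intro definable definable_term_app[OF cdef] def_cand)
  have "definable_term (\<lambda>\<rho>. nxt (\<rho> 0))"
    unfolding nxt_def by (intro definable definable_sep definable_term_app[OF cdef] def_cand)
  note def_nxt = definable_term_app[OF this]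
  define sub where "sub A B \<longleftrightarrow> (\<forall>x. x \<epsilon> A \<longrightarrow> x \<epsilon> B)" for A B
  have sub_trans: "sub A B \<Longrightarrow> sub B C \<Longrightarrow> sub A C" for A B C by (simp add: sub_def)
  have sub_antisym: "sub A B \<Longrightarrow> sub B A \<Longrightarrow> A = B" for A B by (auto simp: sub_def intro: extensionality)
  have def_sub: "definable (\<lambda>\<rho>. sub (\<rho> 0) (\<rho> 1))" unfolding sub_def by (intro definable)
  \<comment> \<open>The empty family \<open>L\<close> puts the empty set into \<open>K\<close>; this
    is the start of the tower.\<close>
  define closed where "closed K \<longleftrightarrow> (\<forall>T. T \<epsilon> K \<longrightarrow> nxt T \<epsilon> K) \<and>
      (\<forall>L. (\<forall>T. T \<epsilon> L \<longrightarrow> T \<epsilon> K) \<longrightarrow> Uni L \<epsilon> K)" for K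
  define tower where
    "tower = sep (Pw X) (\<lambda>T. \<forall>K. (\<forall>S. S \<epsilon> K \<longrightarrow> sub S X) \<longrightarrow> closed K \<longrightarrow> T \<epsilon> K)"
  have mem_tower: "T \<epsilon> tower \<longleftrightarrow> sub T X \<and>
      (\<forall>K. (\<forall>S. S \<epsilon> K \<longrightarrow> sub S X) \<longrightarrow> closed K \<longrightarrow> T \<epsilon> K)" for T
    unfolding tower_def closed_def
    by (subst mem_sep)
      (auto intro!: definable definable_rel[OF def_sub] def_nxt simp: mem_Pw sub_def)
  have nxt_tower: "nxt T \<epsilon> tower" if "T \<epsilon> tower" for T
    using that unfolding mem_tower closed_def by (auto simp: sub_def mem_nxt)
  have Uni_tower: "Uni L \<epsilon> tower" if L: "\<And>T. T \<epsilon> L \<Longrightarrow> T \<epsilon> tower" for L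
    unfolding mem_tower
  proof (intro conjI allI impI)
    show "sub (Uni L) X" using L by (auto simp: mem_tower sub_def mem_Uni)
    fix K assume "\<forall>S. S \<epsilon> K \<longrightarrow> sub S X" "closed K"
    then have "\<forall>T. T \<epsilon> L \<longrightarrow> T \<epsilon> K" using L by (simp add: mem_tower)
    with \<open>closed K\<close> show "Uni L \<epsilon> K" by (simp add: closed_def)
  qed
  have tower_induct: "P T"
    if "T \<epsilon> tower" and P: "definable (\<lambda>\<rho>. P (\<rho> 0))"
      and nxt: "\<And>T. T \<epsilon> tower \<Longrightarrow> P T \<Longrightarrow> P (nxt T)"
      and Uni: "\<And>L. (\<And>T. T \<epsilon> L \<Longrightarrow> T \<epsilon> tower \<and> P T) \<Longrightarrow> P (Uni L)" for P T
  proof -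
    have K: "S \<epsilon> sep tower P \<longleftrightarrow> S \<epsilon> tower \<and> P S" for S by (rule mem_sep[OF P])
    have "closed (sep tower P)"
      unfolding closed_def K using nxt Uni nxt_tower Uni_tower by blast
    moreover have "\<forall>S. S \<epsilon> sep tower P \<longrightarrow> sub S X" by (simp add: K mem_tower)
    ultimately have "T \<epsilon> sep tower P" using that(1) mem_tower by blast
    then show ?thesis by (simp add: K)
  qed
  have sub_nxt: "sub T (nxt T)" if "T \<epsilon> tower" for T
    using that by (simp add: mem_tower sub_def mem_nxt)
  \<comment> \<open>The extreme-point condition of the Bourbaki-Witt argument: no stage properly
    below \<open>C\<close> jumps past \<open>C\<close> in one step.\<close>
  define good where "good C \<longleftrightarrow> (\<forall>T. T \<epsilon> tower \<longrightarrow> sub T C \<longrightarrow> T = C \<or> sub (nxt T) C)" for C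
  have good_cmp: "sub T C \<or> sub (nxt C) T" if "C \<epsilon> tower" "good C" "T \<epsilon> tower" for C T
    using that(3)
  proof (rule tower_induct)
    show "definable (\<lambda>\<rho>. sub (\<rho> 0) C \<or> sub (nxt C) (\<rho> 0))"
      by (intro definable definable_rel[OF def_sub])
  next
    fix T assume "T \<epsilon> tower" "sub T C \<or> sub (nxt C) T"
    then show "sub (nxt T) C \<or> sub (nxt C) (nxt T)"
      using \<open>good C\<close> sub_nxt sub_trans unfolding good_def by (metis sub_def)
  next
    fix L assume "\<And>T. T \<epsilon> L \<Longrightarrow> T \<epsilon> tower \<and> (sub T C \<or> sub (nxt C) T)"
    then show "sub (Uni L) C \<or> sub (nxt C) (Uni L)"
      unfolding sub_def mem_Uni by blast
  qed
  have good: "good C" if "C \<epsilon> tower" for C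
    using that
  proof (rule tower_induct)
    show "definable (\<lambda>\<rho>. good (\<rho> 0))"
      unfolding good_def by (intro definable definable_rel[OF def_sub] def_nxt)
  next
    fix C assume C: "C \<epsilon> tower" "good C"
    show "good (nxt C)"
      unfolding good_def
    proof (intro allI impI)
      fix T assume T: "T \<epsilon> tower" "sub T (nxt C)"
      show "T = nxt C \<or> sub (nxt T) (nxt C)"
      proof (cases "sub T C")
        case True
        then have "T = C \<or> sub (nxt T) C" using C T unfolding good_def by blast
        then show ?thesis using sub_nxt[OF C(1)] sub_trans by (metis sub_def)
      next
        case False
        then show ?thesis using good_cmp[OF C T(1)] T(2) sub_antisym by blast
      qed
    qed
  next
    fix L assume L: "\<And>T. T \<epsilon> L \<Longrightarrow> T \<epsilon> tower \<and> good T"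
    show "good (Uni L)"
      unfolding good_def
    proof (intro allI impI disjCI)
      fix T assume T: "T \<epsilon> tower" "sub T (Uni L)" and "\<not> sub (nxt T) (Uni L)"
      have UL: "sub K (Uni L)" if "K \<epsilon> L" for K using that by (auto simp: sub_def mem_Uni)
      \<comment> \<open>Otherwise \<open>K\<close> lies strictly above \<open>T\<close> by
        \<open>good_cmp\<close>, and goodness of \<open>K\<close> puts \<open>nxt T\<close> below
        \<open>K\<close>, hence below \<open>Uni L\<close>.\<close>
      have "sub K T" if K: "K \<epsilon> L" for K
      proof (rule ccontr)
        assume nK: "\<not> sub K T"
        have "sub T K" using good_cmp[of K T] L[OF K] T(1) nK sub_nxt sub_trans by blast
        then have "sub (nxt T) K" using L[OF K] T(1) nK unfolding good_def by (metis sub_def)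
        then show False using UL[OF K] sub_trans \<open>\<not> sub (nxt T) (Uni L)\<close> by blast
      qed
      then show "T = Uni L" using T(2) by (intro sub_antisym) (auto simp: sub_def mem_Uni)
    qed
  qed
  have chain: "sub S T \<or> sub T S" if "S \<epsilon> tower" "T \<epsilon> tower" for S T
    using good_cmp[OF that(2) good[OF that(2)] that(1)] sub_nxt[OF that(2)] sub_trans by blast
  have indep: "independent R T" if "T \<epsilon> tower" for T
    using that
  proof (rule tower_induct)
    show "definable (\<lambda>\<rho>. independent R (\<rho> 0))"
      unfolding independent_def by (intro definable definable_rel[OF R])
  next
    fix T assume "T \<epsilon> tower" "independent R T"
    then show "independent R (nxt T)"
      unfolding independent_def mem_nxt mem_cand using sym irrefl by blast
  next
    fix L assume L: "\<And>T. T \<epsilon> L \<Longrightarrow> T \<epsilon> tower \<and> independent R T"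
    show "independent R (Uni L)"
      unfolding independent_def mem_Uni
    proof (intro allI impI, elim conjE exE)
      fix x y S T assume *: "S \<epsilon> L" "x \<epsilon> S" "T \<epsilon> L" "y \<epsilon> T"
      then have "sub S T \<or> sub T S" using L chain by blast
      then show "\<not> R x y" using * L unfolding independent_def sub_def by blast
    qed
  qed
  let ?W = "Uni tower"
  have W: "?W \<epsilon> tower" by (rule Uni_tower)
  \<comment> \<open>The union is the largest stage. If it had candidates, the chosen one would
    belong to \<open>nxt ?W\<close> and so to \<open>?W\<close>, against the definition of
    \<open>cand\<close>.\<close>
  have "sub (nxt ?W) ?W" using nxt_tower[OF W] by (auto simp: sub_def mem_Uni)
  then have "\<not> x \<epsilon> cand ?W" for x
    using c[of "cand ?W"] unfolding sub_def mem_nxt by (metis mem_cand)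
  then show thesis
    using W indep[OF W] by (intro that[of ?W]) (auto simp: mem_tower sub_def mem_cand)
qed


section \<open>Consequences of choice for graphs\<close>

lemma pair_commute: "pair a b = pair b a"
  by (auto simp: pair_eq_iff)

lemma graph_edge:
  assumes "zf_graph mem V E" "e \<epsilon> E"
  obtains x y where "x \<epsilon> V" "y \<epsilon> V" "x \<noteq> y" "e = pair x y"
  using assms unfolding zf_graph_def is_upair_iff by blast

lemma graph_no_loop: "zf_graph mem V E \<Longrightarrow> \<not> pair x x \<epsilon> E"
  by (metis graph_edge pair_eq_iff)

text \<open>A maximal independent set dominates by maximality; by independence, a vertex removed
  from it has no neighbour among the remaining ones.\<close>

lemma minimal_dominating_set_if_choice:
  assumes AC: "axiom_of_choice mem" and G: "zf_graph mem V E"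
  shows "\<exists>D. minimal_dominating_set mem V E D"
proof -
  have "definable (\<lambda>\<rho>. pair (\<rho> 0) (\<rho> 1) \<epsilon> E)" by (intro definable)
  then obtain W where W: "\<And>x. x \<epsilon> W \<Longrightarrow> x \<epsilon> V" "independent (\<lambda>x y. pair x y \<epsilon> E) W"
    "\<And>x. x \<epsilon> V \<Longrightarrow> \<not> x \<epsilon> W \<Longrightarrow> \<exists>y. y \<epsilon> W \<and> pair x y \<epsilon> E"
    by (rule maximal_independent_exists[OF AC, where X = V])
      (use graph_no_loop[OF G] pair_commute in auto)
  have "D = W" if D: "\<And>x. x \<epsilon> D \<Longrightarrow> x \<epsilon> W"
    "\<And>v. v \<epsilon> V \<Longrightarrow> v \<epsilon> D \<or> (\<exists>d. d \<epsilon> D \<and> pair v d \<epsilon> E)" for D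
  proof (rule extensionality)
    show "x \<epsilon> D \<longleftrightarrow> x \<epsilon> W" for x
      using D(1) D(2)[of x] W(1)[of x] W(2) unfolding independent_def by blast
  qed
  then have "minimal_dominating_set mem V E W"
    using W(1,3)
    unfolding minimal_dominating_set_def dominating_set_def zf_subset_def zf_adjacent_iff by metis
  then show ?thesis ..
qed

lemma maximal_matching_if_choice:
  assumes AC: "axiom_of_choice mem"
  shows "\<exists>M. maximal_matching mem E M"
proof -
  let ?R = "\<lambda>e e'. e \<noteq> e' \<and> (\<exists>v. v \<epsilon> e \<and> v \<epsilon> e')"
  have "definable (\<lambda>\<rho>. ?R (\<rho> 0) (\<rho> 1))" by (intro definable)
  then obtain M where M: "\<And>x. x \<epsilon> M \<Longrightarrow> x \<epsilon> E" "independent ?R M"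
    "\<And>x. x \<epsilon> E \<Longrightarrow> \<not> x \<epsilon> M \<Longrightarrow> \<exists>y. y \<epsilon> M \<and> ?R x y"
    by (rule maximal_independent_exists[OF AC, where X = E]) auto
  have "M = M'" if sub: "\<And>x. x \<epsilon> M \<Longrightarrow> x \<epsilon> M'" and M': "is_matching mem E M'" for M'
  proof (rule extensionality)
    show "x \<epsilon> M \<longleftrightarrow> x \<epsilon> M'" for x
    proof
      assume x: "x \<epsilon> M'"
      then have "x \<epsilon> E" using M' unfolding is_matching_def zf_subset_def by blast
      show "x \<epsilon> M"
      proof (rule ccontr)
        assume "\<not> x \<epsilon> M"
        then obtain y where "y \<epsilon> M" "?R x y" using M(3) \<open>x \<epsilon> E\<close> by blast
        then show False using M' x sub[of y] unfolding is_matching_def by blast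
      qed
    qed (rule sub)
  qed
  moreover have "is_matching mem E M"
    using M(1,2) unfolding is_matching_def independent_def zf_subset_def by blast
  ultimately show ?thesis unfolding maximal_matching_def zf_subset_def by blast
qed

text \<open>An edge with both ends unmatched could be added to \<open>M\<close>. The form with
  \<open>pair\<close> suits graphs whose edges are known by their ends.\<close>

lemma maximal_matching_pairs:
  assumes G: "zf_graph mem V E" and M: "maximal_matching mem E M"
  shows "e \<epsilon> M \<Longrightarrow> e \<epsilon> E"
    and "pair x y \<epsilon> M \<Longrightarrow> pair x z \<epsilon> M \<Longrightarrow> y = z"
    and "pair x y \<epsilon> E \<Longrightarrow> \<exists>z. pair x z \<epsilon> M \<or> pair y z \<epsilon> M"
proof -
  have ME: "e \<epsilon> E" if "e \<epsilon> M" for e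
    using M that unfolding maximal_matching_def is_matching_def zf_subset_def by blast
  then show "e \<epsilon> M \<Longrightarrow> e \<epsilon> E" .
  have M_unique: "e = e'" if "e \<epsilon> M" "e' \<epsilon> M" "v \<epsilon> e" "v \<epsilon> e'" for e e' v
    using M that unfolding maximal_matching_def is_matching_def by blast
  then show "pair x y \<epsilon> M \<Longrightarrow> pair x z \<epsilon> M \<Longrightarrow> y = z"
    by (metis mem_pair pair_eq_iff)
  assume xy: "pair x y \<epsilon> E"
  show "\<exists>z. pair x z \<epsilon> M \<or> pair y z \<epsilon> M"
  proof (rule ccontr)
    assume contra: "\<nexists>z. pair x z \<epsilon> M \<or> pair y z \<epsilon> M"
    have unmatched: "\<not> x \<epsilon> e \<and> \<not> y \<epsilon> e" if e: "e \<epsilon> M" for e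
    proof -
      obtain p q where pq: "e = pair p q" using graph_edge[OF G ME[OF e]] by blast
      then have "pair p q \<epsilon> M" "pair q p \<epsilon> M" using e pair_commute by metis+
      then show ?thesis using contra unfolding pq mem_pair by blast
    qed
    let ?M = "Uni (pair M (pair (pair x y) (pair x y)))"
    have mem_M: "d \<epsilon> ?M \<longleftrightarrow> d \<epsilon> M \<or> d = pair x y" for d
      by (simp add: mem_Uni_pair mem_pair)
    have "is_matching mem E ?M"
      unfolding is_matching_def zf_subset_def mem_M
      using ME xy M_unique unmatched mem_pair by metis
    moreover have "\<not> pair x y \<epsilon> M" using contra by blast
    ultimately show False
      using M mem_M unfolding maximal_matching_def zf_subset_def by metis
  qed
qed

text \<open>
  Extend a maximal matching by a chosen edge at every unmatched vertex and drop the matching edges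
  both of whose ends are covered by chosen edges.
\<close>

lemma minimal_edge_cover_if_choice:
  assumes AC: "axiom_of_choice mem" and G: "zf_graph mem V E" and noiso: "no_isolated_vertex mem V E"
  shows "\<exists>C. minimal_edge_cover mem V E C"
proof -
  obtain M where M: "maximal_matching mem E M"
    using maximal_matching_if_choice[OF AC] by blast
  note ME = maximal_matching_pairs(1)[OF G M]
  have M_unique: "e = e'" if "e \<epsilon> M" "e' \<epsilon> M" "v \<epsilon> e" "v \<epsilon> e'" for e e' v
    using M that unfolding maximal_matching_def is_matching_def by blast
  define U where "U = sep V (\<lambda>v. \<forall>e. e \<epsilon> M \<longrightarrow> \<not> v \<epsilon> e)"
  have mem_U: "v \<epsilon> U \<longleftrightarrow> v \<epsilon> V \<and> (\<forall>e. e \<epsilon> M \<longrightarrow> \<not> v \<epsilon> e)" for v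
    unfolding U_def by (rule mem_sep) (intro definable)
  \<comment> \<open>By maximality of \<open>M\<close> no edge joins two unmatched vertices, so an
    edge chosen at \<open>v\<close> meets \<open>U\<close> in \<open>v\<close> only.\<close>
  have U_indep: "v = w" if e: "e \<epsilon> E" "v \<epsilon> e" "w \<epsilon> e" and U: "v \<epsilon> U" "w \<epsilon> U" for e v w
  proof (rule ccontr)
    assume "v \<noteq> w"
    obtain x y where "e = pair x y" using graph_edge[OF G e(1)] by blast
    then have "e = pair v w" using e(2,3) \<open>v \<noteq> w\<close> by (auto simp: mem_pair pair_eq_iff)
    then obtain z where "pair v z \<epsilon> M \<or> pair w z \<epsilon> M"
      using e(1) maximal_matching_pairs(3)[OF G M] by blast
    then show False using U mem_U mem_pair by blast
  qed
  obtain c where c: "\<And>S. \<forall>x. x \<epsilon> S \<longrightarrow> x \<epsilon> E \<Longrightarrow> \<exists>x. x \<epsilon> S \<Longrightarrow> c S \<epsilon> S"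
    and cdef: "definable_term (\<lambda>\<rho>. c (\<rho> 0))"
    using choice_on_subsets[OF AC] by blast
  define star where "star v = sep E (\<lambda>e. v \<epsilon> e)" for v
  have mem_star: "e \<epsilon> star v \<longleftrightarrow> e \<epsilon> E \<and> v \<epsilon> e" for e v
    unfolding star_def by (rule mem_sep) (intro definable)
  have "definable_term (\<lambda>\<rho>. star (\<rho> 0))"
    unfolding star_def by (intro definable definable_sep)
  note def_star = definable_term_app[OF this]
  define g where "g v = c (star v)" for v
  have g: "g v \<epsilon> E" "v \<epsilon> g v" if v: "v \<epsilon> V" for v
  proof -
    obtain u where "pair v u \<epsilon> E"
      using noiso v unfolding no_isolated_vertex_def zf_adjacent_iff by blast
    then have "\<exists>e. e \<epsilon> star v" unfolding mem_star by (auto simp: mem_pair)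
    then have "g v \<epsilon> star v" unfolding g_def by (intro c) (auto simp: mem_star)
    then show "g v \<epsilon> E" "v \<epsilon> g v" by (auto simp: mem_star)
  qed
  let ?P = "\<lambda>e. (\<exists>v. v \<epsilon> U \<and> e = g v) \<or>
    (e \<epsilon> M \<and> (\<exists>x. x \<epsilon> e \<and> (\<forall>v. v \<epsilon> U \<longrightarrow> \<not> x \<epsilon> g v)))"
  define C where "C = sep E ?P"
  have "definable (\<lambda>\<rho>. ?P (\<rho> 0))"
    unfolding g_def by (intro definable definable_term_app[OF cdef] def_star)
  then have mem_C: "e \<epsilon> C \<longleftrightarrow> e \<epsilon> E \<and> ?P e" for e
    unfolding C_def by (rule mem_sep)
  have cover: "\<exists>e. e \<epsilon> C \<and> v \<epsilon> e" if v: "v \<epsilon> V" for v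
  proof (cases "\<exists>w. w \<epsilon> U \<and> v \<epsilon> g w")
    case True
    then show ?thesis using mem_C g(1) mem_U by blast
  next
    case False
    then have "\<not> v \<epsilon> U" using g(2)[OF v] by blast
    then obtain e where "e \<epsilon> M" "v \<epsilon> e" using mem_U v by blast
    then show ?thesis using False mem_C ME by blast
  qed
  \<comment> \<open>Every edge of \<open>C\<close> has a vertex on no other edge of
    \<open>C\<close>: \<open>v\<close> for a chosen edge \<open>g v\<close>, and for a matching edge
    an end that the chosen edges miss.\<close>
  have "C' = C" if sub: "\<And>e. e \<epsilon> C' \<Longrightarrow> e \<epsilon> C"
    and cov: "\<And>v. v \<epsilon> V \<Longrightarrow> \<exists>e. e \<epsilon> C' \<and> v \<epsilon> e" for C'
  proof (rule extensionality, rule iffI, erule sub)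
    fix e assume "e \<epsilon> C"
    then consider v where "v \<epsilon> U" "e = g v"
      | x where "e \<epsilon> M" "x \<epsilon> e" "\<forall>v. v \<epsilon> U \<longrightarrow> \<not> x \<epsilon> g v"
      unfolding mem_C by blast
    then show "e \<epsilon> C'"
    proof cases
      case 1
      then have v: "v \<epsilon> V" by (simp add: mem_U)
      obtain d where d: "d \<epsilon> C'" "v \<epsilon> d" using cov[OF v] by blast
      have "\<not> d \<epsilon> M" using 1 d(2) mem_U by blast
      then obtain w where w: "w \<epsilon> U" "d = g w" using sub[OF d(1)] mem_C by blast
      then have "w \<epsilon> V" by (simp add: mem_U)
      then have "v = w" using U_indep[of d v w] g d(2) w 1 by blast
      then show ?thesis using d(1) w(2) 1(2) by simp
    next
      case 2
      obtain y z where "y \<epsilon> V" "z \<epsilon> V" "e = pair y z" using graph_edge[OF G ME[OF 2(1)]] by blast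
      then have "x \<epsilon> V" using 2(2) by (auto simp: mem_pair)
      then obtain d where d: "d \<epsilon> C'" "x \<epsilon> d" using cov by blast
      then have "d \<epsilon> M" using sub[OF d(1)] 2(3) unfolding mem_C by blast
      then show ?thesis using M_unique 2(1,2) d by blast
    qed
  qed
  then have "minimal_edge_cover mem V E C"
    using cover mem_C
    unfolding minimal_edge_cover_def edge_cover_def zf_subset_def by blast
  then show ?thesis ..
qed


section \<open>Constructing connected graphs\<close>

text \<open>The standard naturals of the model; there may be others.\<close>

primrec num :: "nat \<Rightarrow> 'm" where
  "num 0 = empt"
| "num (Suc n) = succ (num n)"

lemma natural_num: "is_natural mem (num n)"
  by (induction n) (auto simp: is_natural_def is_inductive_def is_empty_iff is_succ_iff)

lemma mem_num: "z \<epsilon> num n \<longleftrightarrow> (\<exists>i<n. z = num i)"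
  by (induction n) (auto simp: mem_empt mem_succ less_Suc_eq)

lemma num_inject: "num i = num j \<longleftrightarrow> i = j"
  by (metis mem_irrefl mem_num nat_neq_iff)

lemma finite_set_exists: "\<exists>B. \<forall>x. x \<epsilon> B \<longleftrightarrow> x \<in> set xs"
proof (induction xs)
  case Nil
  then show ?case using mem_empt by auto
next
  case (Cons a xs)
  then obtain B where "\<forall>x. x \<epsilon> B \<longleftrightarrow> x \<in> set xs" by blast
  then have "\<forall>x. x \<epsilon> Uni (pair B (pair a a)) \<longleftrightarrow> x \<in> set (a # xs)"
    by (auto simp: mem_Uni_pair mem_pair)
  then show ?case by blast
qed

text \<open>The map from \<open>num i\<close> to \<open>xs ! i\<close> is an externally finite set
  of pairs, hence a set of the model.\<close>

lemma path_if_list: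
  assumes xs: "xs \<noteq> []" "distinct xs" "\<And>x. x \<in> set xs \<Longrightarrow> x \<epsilon> V"
    and adj: "successively (\<lambda>x y. pair x y \<epsilon> E) xs"
  shows "\<exists>n f. zf_path mem V E n f (hd xs) (last xs)"
proof -
  obtain f where "\<forall>p. p \<epsilon> f \<longleftrightarrow> p \<in> set (map (\<lambda>i. opair (num i) (xs ! i)) [0..<length xs])"
    using finite_set_exists by blast
  then have f: "p \<epsilon> f \<longleftrightarrow> (\<exists>i<length xs. p = opair (num i) (xs ! i))" for p by auto
  have app: "zf_app mem f x y \<longleftrightarrow> (\<exists>i<length xs. x = num i \<and> y = xs ! i)" for x y
    by (auto simp: zf_app_iff f opair_inject)
  \<comment> \<open>The length \<open>n\<close> counts edges, one fewer than the vertices, and the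
    domain is the successor of \<open>num n\<close>.\<close>
  obtain n where n: "length xs = Suc n" using xs(1) by (cases xs) auto
  have fn: "zf_function_on mem (succ (num n)) f"
    unfolding zf_function_on_def is_opair_iff f app
    using mem_num[of _ "Suc n"] by (auto simp: n num_inject)
  have inj: "i = j" if "zf_app mem f i v" "zf_app mem f j v" for i j v
    using that xs(2) unfolding app by (metis nth_eq_iff_index_eq)
  have ran: "v \<epsilon> V" if "zf_app mem f i v" for i v
    using that xs(3) unfolding app by auto
  have start: "zf_app mem f empt (hd xs)"
    unfolding app using xs(1) by (intro exI[of _ 0]) (simp add: hd_conv_nth)
  have stop: "zf_app mem f (num n) (last xs)"
    unfolding app using xs(1) by (intro exI[of _ n]) (simp add: last_conv_nth n)
  have step: "\<exists>u v. zf_app mem f i u \<and> zf_app mem f (succ i) v \<and> pair u v \<epsilon> E"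
    if i: "i \<epsilon> num n" for i
  proof -
    obtain k where k: "k < n" "i = num k" using i unfolding mem_num by blast
    have "zf_app mem f (num j) (xs ! j)" if "j \<le> n" for j
      unfolding app using that n by (intro exI[of _ j]) simp
    from this[of k] this[of "Suc k"]
    have "zf_app mem f i (xs ! k)" "zf_app mem f (succ i) (xs ! Suc k)"
      using k by simp_all
    moreover have "pair (xs ! k) (xs ! Suc k) \<epsilon> E"
      using adj k(1) n by (simp add: successively_conv_nth)
    ultimately show ?thesis by blast
  qed
  have "zf_path mem V E (num n) f (hd xs) (last xs)"
    unfolding zf_path_def is_succ_iff is_empty_iff zf_adjacent_iff
  proof (intro conjI allI impI, goal_cases)
    case (3 i v)
    then show ?case by (rule ran)
  next
    case (4 i j v)
    then show ?case using inj by blast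
  next
    case (7 i)
    then show ?case using step by blast
  qed (use natural_num fn start stop in auto)
  then show ?thesis by blast
qed

text \<open>Paths are injective, so a walk that returns to a vertex is cut back to its first visit
  there.\<close>

lemma path_if_rtranclp:
  assumes "(\<lambda>u v. u \<epsilon> V \<and> v \<epsilon> V \<and> pair u v \<epsilon> E)\<^sup>*\<^sup>* x y" and x: "x \<epsilon> V"
  shows "\<exists>n f. zf_path mem V E n f x y"
proof -
  let ?path = "\<lambda>xs y. xs \<noteq> [] \<and> distinct xs \<and> (\<forall>v\<in>set xs. v \<epsilon> V) \<and>
    successively (\<lambda>x y. pair x y \<epsilon> E) xs \<and> hd xs = x \<and> last xs = y"
  from assms(1) have "\<exists>xs. ?path xs y"
  proof (induction rule: rtranclp_induct)
    case base
    show ?case using x by (intro exI[of _ "[x]"]) simp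
  next
    case (step y z)
    then obtain xs where xs: "?path xs y" by blast
    show ?case
    proof (cases "z \<in> set xs")
      case True
      then obtain ys zs where ys: "xs = (ys @ [z]) @ zs" using split_list[of z xs] by auto
      have "successively (\<lambda>x y. pair x y \<epsilon> E) (ys @ [z])"
        using xs unfolding ys successively_append_iff by blast
      moreover have "hd (ys @ [z]) = x" using xs unfolding ys by (cases ys) auto
      ultimately have "?path (ys @ [z]) z" using xs unfolding ys by simp
      then show ?thesis by blast
    next
      case False
      then have "?path (xs @ [z]) z"
        using xs step.hyps(2) by (auto simp: successively_append_iff)
      then show ?thesis by blast
    qed
  qed
  then obtain xs where xs: "?path xs y" by blast
  then have "\<exists>n f. zf_path mem V E n f (hd xs) (last xs)" by (intro path_if_list) auto
  then show ?thesis using xs by simp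
qed

lemma connected_if_hub:
  assumes "\<And>x. x \<epsilon> V \<Longrightarrow> (\<lambda>u v. u \<epsilon> V \<and> v \<epsilon> V \<and> pair u v \<epsilon> E)\<^sup>*\<^sup>* x r"
  shows "zf_connected mem V E"
  unfolding zf_connected_def
proof (intro allI impI path_if_rtranclp)
  let ?R = "\<lambda>u v. u \<epsilon> V \<and> v \<epsilon> V \<and> pair u v \<epsilon> E"
  have sym: "symp ?R\<^sup>*\<^sup>*" by (rule symp_rtranclp) (auto simp: symp_def pair_commute)
  fix x y assume "x \<epsilon> V \<and> y \<epsilon> V"
  then show "?R\<^sup>*\<^sup>* x y" using assms sympD[OF sym] by (meson rtranclp_trans)
qed simp

section \<open>Graphs of definable relations and graphs with a hub\<close>

lemma graph_if_relation:
  assumes R: "definable (\<lambda>\<rho>. R (\<rho> 0) (\<rho> 1))"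
    and sym: "\<And>x y. R x y \<Longrightarrow> R y x" and irrefl: "\<And>x. \<not> R x x"
  obtains E where "zf_graph mem V E" "\<And>x y. pair x y \<epsilon> E \<longleftrightarrow> x \<epsilon> V \<and> y \<epsilon> V \<and> R x y"
proof
  let ?P = "\<lambda>e. \<exists>x y. x \<epsilon> V \<and> y \<epsilon> V \<and> R x y \<and> e = pair x y"
  have "definable (\<lambda>\<rho>. ?P (\<rho> 0))" by (intro definable definable_rel[OF R])
  then have E: "e \<epsilon> sep (Pw V) ?P \<longleftrightarrow> ?P e" for e
    by (subst mem_sep) (auto simp: mem_Pw mem_pair)
  show "zf_graph mem V (sep (Pw V) ?P)"
    unfolding zf_graph_def is_upair_iff E using irrefl by metis
  show "pair x y \<epsilon> sep (Pw V) ?P \<longleftrightarrow> x \<epsilon> V \<and> y \<epsilon> V \<and> R x y" for x y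
    unfolding E pair_eq_iff using sym by blast
qed

text \<open>The tag separates inner from outer vertices where \<open>G A\<close> meets
  \<open>A\<close>, and the component \<open>A\<close> separates overlapping members of the family.
  No ordered pair is empty, which leaves \<open>empt\<close> free for the hub.\<close>

definition inner :: "'m \<Rightarrow> 'm \<Rightarrow> 'm" where
  "inner A a = opair empt (opair A a)"

definition outer :: "'m \<Rightarrow> 'm \<Rightarrow> 'm" where
  "outer A s = opair (pair empt empt) (opair A s)"

lemma pair_neq_empt: "pair a b \<noteq> empt"
  by (metis mem_empt mem_pair)

lemma vertex_simps [simp]:
  "inner A a = inner B b \<longleftrightarrow> A = B \<and> a = b"
  "outer A s = outer B t \<longleftrightarrow> A = B \<and> s = t"
  "inner A a \<noteq> outer B t" "outer B t \<noteq> inner A a"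
  "inner A a \<noteq> empt" "empt \<noteq> inner A a" "outer A s \<noteq> empt" "empt \<noteq> outer A s"
  unfolding inner_def outer_def opair_inject
  using pair_neq_empt pair_neq_empt[symmetric] by (auto simp: opair_def)

lemma definable_inner:
  "definable_term t \<Longrightarrow> definable_term u \<Longrightarrow> definable_term (\<lambda>\<rho>. inner (t \<rho>) (u \<rho>))"
  unfolding inner_def by (intro definable_opair definable_term_const)

lemma definable_outer:
  "definable_term t \<Longrightarrow> definable_term u \<Longrightarrow> definable_term (\<lambda>\<rho>. outer (t \<rho>) (u \<rho>))"
  unfolding outer_def by (intro definable_opair definable_term_const)

definition hub_vertex :: "'m \<Rightarrow> ('m \<Rightarrow> 'm) \<Rightarrow> 'm \<Rightarrow> bool" where
  "hub_vertex F G v \<longleftrightarrow> v = empt \<or> (\<exists>A. A \<epsilon> F \<and>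
     ((\<exists>a. a \<epsilon> A \<and> v = inner A a) \<or> (\<exists>s. s \<epsilon> G A \<and> v = outer A s)))"

text \<open>Oriented away from the inner end, which later gives the bipartition.\<close>

definition hub_edge :: "'m \<Rightarrow> ('m \<Rightarrow> 'm) \<Rightarrow> 'm \<Rightarrow> 'm \<Rightarrow> bool" where
  "hub_edge F G x y \<longleftrightarrow> (\<exists>A a. A \<epsilon> F \<and> a \<epsilon> A \<and> x = inner A a \<and>
     (y = empt \<or> (\<exists>s. s \<epsilon> G A \<and> y = outer A s)))"

text \<open>\<open>Z\<close> bounds all \<open>G A\<close> at once, so that the vertices can be
  separated from one set; \<open>R\<close> supplies additional edges. As \<open>A\<close> is
  nonempty, each outer vertex reaches the hub through an inner one.\<close>

lemma hub_graph_exists: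
  assumes nonempty: "\<forall>A. A \<epsilon> F \<longrightarrow> (\<exists>a. a \<epsilon> A)"
    and G: "definable_term (\<lambda>\<rho>. G (\<rho> 0))" and bound: "\<And>A s. A \<epsilon> F \<Longrightarrow> s \<epsilon> G A \<Longrightarrow> s \<epsilon> Z"
    and R: "definable (\<lambda>\<rho>. R (\<rho> 0) (\<rho> 1))"
    and sym: "\<And>x y. R x y \<Longrightarrow> R y x" and irrefl: "\<And>x. \<not> R x x"
  obtains V E where "zf_graph mem V E" "zf_connected mem V E"
    "\<And>v. v \<epsilon> V \<longleftrightarrow> hub_vertex F G v"
    "\<And>x y. pair x y \<epsilon> E \<longleftrightarrow> x \<epsilon> V \<and> y \<epsilon> V \<and> (hub_edge F G x y \<or> hub_edge F G y x \<or> R x y)"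
proof -
  define Q where "Q = Pw (Pw (Uni (pair F (Uni (pair (Uni F) Z)))))"
  define B where "B = Uni (pair (pair empt empt)
      (Pw (Pw (Uni (pair (pair empt (pair empt empt)) Q)))))"
  have Q: "opair A a \<epsilon> Q" if "A \<epsilon> F" "a \<epsilon> A \<or> a \<epsilon> Z" for A a
    unfolding Q_def
    by (rule opair_mem_Pw[OF that(1)]) (use that in \<open>auto simp: mem_Uni_pair mem_Uni[of _ F]\<close>)
  have empt_B: "empt \<epsilon> B" unfolding B_def mem_Uni_pair mem_pair by auto
  have B: "opair i q \<epsilon> B" if "i = empt \<or> i = pair empt empt" "q \<epsilon> Q" for i q
  proof -
    have "opair i q \<epsilon> Pw (Pw (Uni (pair (pair empt (pair empt empt)) Q)))"
      by (rule opair_mem_Pw) (use that in \<open>auto simp: mem_pair\<close>)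
    then show ?thesis unfolding B_def mem_Uni_pair by blast
  qed
  note G' = definable_term_app[OF G]
  define V where "V = sep B (hub_vertex F G)"
  have "definable (\<lambda>\<rho>. hub_vertex F G (\<rho> 0))"
    unfolding hub_vertex_def by (intro definable definable_inner definable_outer G')
  then have "v \<epsilon> V \<longleftrightarrow> v \<epsilon> B \<and> hub_vertex F G v" for v
    unfolding V_def by (rule mem_sep)
  moreover have "v \<epsilon> B" if "hub_vertex F G v" for v
    using that empt_B unfolding hub_vertex_def inner_def outer_def
    by (elim disjE exE conjE) (auto intro!: B Q dest: bound)
  ultimately have V: "v \<epsilon> V \<longleftrightarrow> hub_vertex F G v" for v by blast
  have "definable (\<lambda>\<rho>. hub_edge F G (\<rho> 0) (\<rho> 1) \<or> hub_edge F G (\<rho> 1) (\<rho> 0) \<or> R (\<rho> 0) (\<rho> 1))"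
    unfolding hub_edge_def by (intro definable definable_inner definable_outer G' R)
  then obtain E where E: "zf_graph mem V E"
    "\<And>x y. pair x y \<epsilon> E \<longleftrightarrow> x \<epsilon> V \<and> y \<epsilon> V \<and> (hub_edge F G x y \<or> hub_edge F G y x \<or> R x y)"
    by (rule graph_if_relation) (use sym irrefl in \<open>auto simp: hub_edge_def\<close>)
  let ?R = "\<lambda>u v. u \<epsilon> V \<and> v \<epsilon> V \<and> pair u v \<epsilon> E"
  have hub: "empt \<epsilon> V" by (simp add: V hub_vertex_def)
  have inner: "?R (inner A a) empt" if "A \<epsilon> F" "a \<epsilon> A" for A a
    using that hub unfolding E(2) V hub_vertex_def hub_edge_def by blast
  have outer: "?R (outer A s) (inner A a)" if "A \<epsilon> F" "a \<epsilon> A" "s \<epsilon> G A" for A a s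
    using that unfolding E(2) V hub_vertex_def hub_edge_def by blast
  have "?R\<^sup>*\<^sup>* x empt" if "x \<epsilon> V" for x
    using that[unfolded V hub_vertex_def]
  proof (elim disjE exE conjE)
    fix A a assume "A \<epsilon> F" "a \<epsilon> A" "x = inner A a"
    then show ?thesis using inner by (intro r_into_rtranclp) blast
  next
    fix A s assume A: "A \<epsilon> F" "s \<epsilon> G A" "x = outer A s"
    then obtain a where a: "a \<epsilon> A" using nonempty by blast
    have "?R\<^sup>*\<^sup>* x (inner A a)" by (rule r_into_rtranclp) (use outer[of A a s] A a in simp)
    moreover have "?R\<^sup>*\<^sup>* (inner A a) empt"
      by (rule r_into_rtranclp) (use inner[of A a] A a in simp)
    ultimately show ?thesis by (rule rtranclp_trans)
  qed auto
  then have "zf_connected mem V E" by (rule connected_if_hub)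
  with E V show thesis by (intro that[of V E])
qed

text \<open>With hub edges only, every edge has exactly one inner end.\<close>

lemma hub_graph_bipartite:
  assumes "zf_graph mem V E" and V: "\<And>v. v \<epsilon> V \<longleftrightarrow> hub_vertex F G v"
    and E: "\<And>x y. pair x y \<epsilon> E \<Longrightarrow> hub_edge F G x y \<or> hub_edge F G y x"
  shows "zf_bipartite mem V E"
proof -
  define P where "P v \<longleftrightarrow> (\<exists>A a. A \<epsilon> F \<and> a \<epsilon> A \<and> v = inner A a)" for v
  define X where "X = sep V P"
  define Y where "Y = sep V (\<lambda>v. \<not> P v)"
  have P: "definable (\<lambda>\<rho>. P (\<rho> 0))" unfolding P_def by (intro definable definable_inner)
  have X: "v \<epsilon> X \<longleftrightarrow> v \<epsilon> V \<and> P v" and Y: "v \<epsilon> Y \<longleftrightarrow> v \<epsilon> V \<and> \<not> P v" for v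
    unfolding X_def Y_def by (rule mem_sep, intro P definable_Neg)+
  have edge: "P x \<and> \<not> P y" if "hub_edge F G x y" for x y
    using that by (auto simp: hub_edge_def P_def)
  have "\<exists>a b. a \<epsilon> X \<and> b \<epsilon> Y \<and> e = pair a b" if e: "e \<epsilon> E" for e
  proof -
    obtain x y where xy: "x \<epsilon> V" "y \<epsilon> V" "e = pair x y" using graph_edge[OF assms(1) e] by blast
    then have "P x \<and> \<not> P y \<or> P y \<and> \<not> P x" using E e edge by metis
    then show ?thesis unfolding X Y using xy pair_commute by metis
  qed
  moreover have "v \<epsilon> V \<longleftrightarrow> v \<epsilon> X \<or> v \<epsilon> Y" "\<not> (v \<epsilon> X \<and> v \<epsilon> Y)" for v
    using X Y by blast+
  ultimately show ?thesis unfolding zf_bipartite_def is_upair_iff by blast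
qed


section \<open>Choice from graphs\<close>

text \<open>By minimality \<open>D\<close> without \<open>x\<close> fails to dominate some vertex,
  and that vertex is dominated by \<open>x\<close> alone.\<close>

lemma private_neighbour:
  assumes D: "minimal_dominating_set mem V E D" and x: "x \<epsilon> D"
  obtains v where "v \<epsilon> V" "v = x \<or> pair v x \<epsilon> E"
    "\<And>d. d \<epsilon> D \<Longrightarrow> d = v \<or> pair v d \<epsilon> E \<Longrightarrow> d = x"
proof -
  let ?D = "sep D (\<lambda>d. d \<noteq> x)"
  have mem_D: "d \<epsilon> ?D \<longleftrightarrow> d \<epsilon> D \<and> d \<noteq> x" for d by (rule mem_sep) (intro definable)
  have "dominating_set mem V E D" using D by (simp add: minimal_dominating_set_def)
  moreover have "?D \<noteq> D" using x mem_D by metis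
  then have "\<not> dominating_set mem V E ?D"
    using D mem_D unfolding minimal_dominating_set_def zf_subset_def by blast
  ultimately obtain v where v: "v \<epsilon> V" "v \<epsilon> D \<or> (\<exists>d. d \<epsilon> D \<and> pair v d \<epsilon> E)"
    "\<not> (v \<epsilon> ?D \<or> (\<exists>d. d \<epsilon> ?D \<and> pair v d \<epsilon> E))"
    unfolding dominating_set_def zf_subset_def zf_adjacent_iff using mem_D by blast
  show thesis
  proof (rule that[OF v(1)])
    show "v = x \<or> pair v x \<epsilon> E" using v(2,3) unfolding mem_D by blast
    show "d = x" if "d \<epsilon> D" "d = v \<or> pair v d \<epsilon> E" for d
      using v(3) that unfolding mem_D by blast
  qed
qed

text \<open>
  With \<open>G A = A\<close> and the vertices over \<open>A\<close> forming a clique, a minimal dominating set meets each of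
  these cliques in exactly one vertex: the outer vertices are dominated only from inside, and a
  private neighbour of either of two vertices would have to be the hub.
\<close>

lemma choice_if_minimal_dominating_sets:
  assumes dom: "connected_graphs_have_minimal_dominating_sets mem"
  shows "axiom_of_choice mem"
  unfolding axiom_of_choice_def
proof (intro allI impI)
  fix F assume nonempty: "\<forall>A. A \<epsilon> F \<longrightarrow> (\<exists>a. a \<epsilon> A)"
  define over where "over A x \<longleftrightarrow> (\<exists>a. a \<epsilon> A \<and> (x = inner A a \<or> x = outer A a))" for A x
  have def_over: "definable (\<lambda>\<rho>. over (\<rho> 0) (\<rho> 1))"
    unfolding over_def by (intro definable definable_inner definable_outer)
  let ?G = "\<lambda>A. A"
  let ?R = "\<lambda>x y. x \<noteq> y \<and> (\<exists>A. A \<epsilon> F \<and> over A x \<and> over A y)"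
  have "definable (\<lambda>\<rho>. ?R (\<rho> 0) (\<rho> 1))" by (intro definable definable_rel[OF def_over])
  note hub = hub_graph_exists[where R = ?R and G = ?G and Z = "Uni F",
      OF nonempty definable_term_var _ this]
  obtain V E where G: "zf_graph mem V E" "zf_connected mem V E"
    and V: "\<And>v. v \<epsilon> V \<longleftrightarrow> hub_vertex F ?G v"
    and E: "\<And>x y. pair x y \<epsilon> E \<longleftrightarrow>
      x \<epsilon> V \<and> y \<epsilon> V \<and> (hub_edge F ?G x y \<or> hub_edge F ?G y x \<or> ?R x y)"
    by (rule hub) (auto simp: mem_Uni)
  obtain D where D: "minimal_dominating_set mem V E D"
    using dom G unfolding connected_graphs_have_minimal_dominating_sets_def by blast
  then have DV: "d \<epsilon> V" if "d \<epsilon> D" for d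
    using that unfolding minimal_dominating_set_def dominating_set_def zf_subset_def by blast
  have D_dom: "v \<epsilon> D \<or> (\<exists>d. d \<epsilon> D \<and> pair v d \<epsilon> E)" if "v \<epsilon> V" for v
    using that D
    unfolding minimal_dominating_set_def dominating_set_def zf_subset_def zf_adjacent_iff by blast
  have over_V: "x \<epsilon> V" if "A \<epsilon> F" "over A x" for A x
    using that unfolding V hub_vertex_def over_def by blast
  have nbr: "over A v \<or> v = empt" if "over A x" "pair v x \<epsilon> E" for A v x
    using that unfolding E hub_edge_def over_def by auto
  have unique: "x = y"
    if A: "A \<epsilon> F" and x: "x \<epsilon> D" "over A x" and y: "y \<epsilon> D" "over A y" for A x y
  proof (rule ccontr)
    assume "x \<noteq> y"
    have hub: "pair empt p \<epsilon> E"
      if pq: "p \<epsilon> D" "over A p" "q \<epsilon> D" "over A q" "p \<noteq> q" for p q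
    proof -
      obtain v where v: "v \<epsilon> V" "v = p \<or> pair v p \<epsilon> E"
        "\<And>d. d \<epsilon> D \<Longrightarrow> d = v \<or> pair v d \<epsilon> E \<Longrightarrow> d = p"
        using private_neighbour[OF D pq(1)] by blast
      \<comment> \<open>In the clique over \<open>A\<close>, such a \<open>v\<close> would be equal
        or adjacent to \<open>q\<close> as well.\<close>
      have "\<not> over A v"
      proof
        assume "over A v"
        then have "q = v \<or> pair v q \<epsilon> E" using A pq over_V unfolding E by blast
        then show False using v(3) pq by blast
      qed
      then have "v = empt" "pair v p \<epsilon> E" using v(2) nbr pq(2) by blast+
      then show ?thesis by simp
    qed
    \<comment> \<open>Now the hub is adjacent to both vertices and hence private to neither.\<close>
    have "pair empt x \<epsilon> E" "pair empt y \<epsilon> E" using hub x y \<open>x \<noteq> y\<close> by blast+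
    obtain v where v: "v = x \<or> pair v x \<epsilon> E"
      "\<And>d. d \<epsilon> D \<Longrightarrow> d = v \<or> pair v d \<epsilon> E \<Longrightarrow> d = x"
      using private_neighbour[OF D x(1)] by blast
    have "over A v \<or> v = empt" using v(1) nbr x(2) by blast
    then have "y = v \<or> pair v y \<epsilon> E"
    proof
      assume "over A v"
      then show ?thesis using A y over_V unfolding E by blast
    qed (use \<open>pair empt y \<epsilon> E\<close> in simp)
    then show False using v(2) y(1) \<open>x \<noteq> y\<close> by blast
  qed
  show "\<exists>f. zf_function_on mem F f \<and> (\<forall>A a. A \<epsilon> F \<and> zf_app mem f A a \<longrightarrow> a \<epsilon> A)"
  proof (rule choice_from_relation)
    show "definable (\<lambda>\<rho>. inner (\<rho> 0) (\<rho> 1) \<epsilon> D \<or> outer (\<rho> 0) (\<rho> 1) \<epsilon> D)"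
      by (intro definable definable_inner definable_outer)
    fix A assume A: "A \<epsilon> F"
    then obtain b where b: "b \<epsilon> A" using nonempty by blast
    then have ob: "over A (outer A b)" by (auto simp: over_def)
    have "\<exists>x. x \<epsilon> D \<and> over A x"
    proof (cases "outer A b \<epsilon> D")
      case False
      then obtain d where d: "d \<epsilon> D" "pair (outer A b) d \<epsilon> E"
        using D_dom over_V[OF A ob] by blast
      then have "over A d" unfolding E hub_edge_def over_def by auto
      then show ?thesis using d by blast
    qed (use ob in blast)
    then obtain a where a: "a \<epsilon> A" "inner A a \<epsilon> D \<or> outer A a \<epsilon> D"
      unfolding over_def by blast
    show "\<exists>!a. a \<epsilon> A \<and> (inner A a \<epsilon> D \<or> outer A a \<epsilon> D)"
    proof (rule ex1I[of _ a])
      fix c assume c: "c \<epsilon> A \<and> (inner A c \<epsilon> D \<or> outer A c \<epsilon> D)"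
      obtain x where x: "x \<epsilon> D" "x = inner A a \<or> x = outer A a" using a by blast
      obtain y where y: "y \<epsilon> D" "y = inner A c \<or> y = outer A c" using c by blast
      have "over A x" "over A y" using x y a c unfolding over_def by blast+
      then have "x = y" using unique A x y by blast
      then show "c = a" using x y by auto
    qed (use a in blast)
  qed
qed

text \<open>
  With a single outer vertex \<open>outer A empt\<close> for each \<open>A\<close>, a maximal matching selects the inner
  vertex matched to it; the hub can block this for one singleton \<open>A\<close> only, and then it selects.
\<close>

lemma choice_if_maximal_matchings:
  assumes match: "connected_bipartite_graphs_have_maximal_matchings mem"
  shows "axiom_of_choice mem"
  unfolding axiom_of_choice_def
proof (intro allI impI)
  fix F assume nonempty: "\<forall>A. A \<epsilon> F \<longrightarrow> (\<exists>a. a \<epsilon> A)"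
  let ?G = "\<lambda>A::'m. pair empt empt"
  \<comment> \<open>No additional edges: falsity in a form that the definability rules
    accept.\<close>
  let ?R = "\<lambda>x y::'m. x \<noteq> x"
  have "definable (\<lambda>\<rho>. ?R (\<rho> 0) (\<rho> 1))" by (intro definable)
  note hub = hub_graph_exists[where R = ?R and G = ?G and Z = "pair empt empt",
      OF nonempty definable_term_const _ this]
  obtain V E where G: "zf_graph mem V E" "zf_connected mem V E"
    and V: "\<And>v. v \<epsilon> V \<longleftrightarrow> hub_vertex F ?G v"
    and E': "\<And>x y. pair x y \<epsilon> E \<longleftrightarrow>
      x \<epsilon> V \<and> y \<epsilon> V \<and> (hub_edge F ?G x y \<or> hub_edge F ?G y x \<or> x \<noteq> x)"
    by (rule hub) auto
  have E: "pair x y \<epsilon> E \<longleftrightarrow> x \<epsilon> V \<and> y \<epsilon> V \<and> (hub_edge F ?G x y \<or> hub_edge F ?G y x)" for x y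
    unfolding E' by blast
  have "zf_bipartite mem V E"
    by (rule hub_graph_bipartite[OF G(1) V]) (use E in blast)
  then obtain M where M: "maximal_matching mem E M"
    using match G unfolding connected_bipartite_graphs_have_maximal_matchings_def by blast
  note ME = maximal_matching_pairs(1)[OF G(1) M] and M_unique = maximal_matching_pairs(2)[OF G(1) M]
    and M_max = maximal_matching_pairs(3)[OF G(1) M]
  \<comment> \<open>The second clause is for an unmatched \<open>outer A empt\<close>: maximality
    then matches every inner vertex over \<open>A\<close>, and the hub is the only partner
    left.\<close>
  let ?C = "\<lambda>A a. pair (outer A empt) (inner A a) \<epsilon> M \<or>
    (\<forall>b. \<not> pair (outer A empt) (inner A b) \<epsilon> M) \<and> pair empt (inner A a) \<epsilon> M"
  show "\<exists>f. zf_function_on mem F f \<and> (\<forall>A a. A \<epsilon> F \<and> zf_app mem f A a \<longrightarrow> a \<epsilon> A)"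
  proof (rule choice_from_relation)
    show "definable (\<lambda>\<rho>. ?C (\<rho> 0) (\<rho> 1))"
      by (intro definable definable_inner definable_outer)
    fix A assume A: "A \<epsilon> F"
    have outer_nbr: "\<exists>a. a \<epsilon> A \<and> y = inner A a" if "pair (outer A empt) y \<epsilon> E" for y
      using that unfolding E hub_edge_def by auto
    have inner_nbr: "y = empt \<or> y = outer A empt" if "pair (inner A a) y \<epsilon> E" for a y
      using that unfolding E hub_edge_def by (auto simp: mem_pair)
    have "\<exists>a. a \<epsilon> A \<and> ?C A a"
    proof (cases "\<exists>b. pair (outer A empt) (inner A b) \<epsilon> M")
      case True
      then obtain b where b: "pair (outer A empt) (inner A b) \<epsilon> M" by blast
      then have "b \<epsilon> A" using outer_nbr[OF ME[OF b]] by auto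
      then show ?thesis using b by blast
    next
      case False
      obtain a where a: "a \<epsilon> A" using nonempty A by blast
      have "pair (inner A a) (outer A empt) \<epsilon> E"
        unfolding E V hub_vertex_def hub_edge_def mem_pair using A a by blast
      then obtain z where "pair (inner A a) z \<epsilon> M \<or> pair (outer A empt) z \<epsilon> M"
        using M_max by blast
      then have "pair (inner A a) empt \<epsilon> M"
      proof
        assume z: "pair (inner A a) z \<epsilon> M"
        then have "z \<noteq> outer A empt" using False pair_commute by metis
        then show ?thesis using z inner_nbr[OF ME[OF z]] by blast
      next
        assume z: "pair (outer A empt) z \<epsilon> M"
        then show ?thesis using False outer_nbr[OF ME[OF z]] by blast
      qed
      then show ?thesis using False a pair_commute by metis
    qed
    \<comment> \<open>The clauses exclude each other, so both edges share the outer vertex or the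
      hub.\<close>
    moreover have "a = b" if "?C A a" "?C A b" for a b
    proof -
      have "inner A a = inner A b"
        using that M_unique[of _ "inner A a" "inner A b"] by blast
      then show ?thesis by simp
    qed
    ultimately show "\<exists>!a. a \<epsilon> A \<and> ?C A a" by blast
  qed
qed

text \<open>An edge whose ends both have another incident edge in the cover would be redundant.\<close>

lemma minimal_edge_cover_pairs:
  assumes G: "zf_graph mem V E" and C: "minimal_edge_cover mem V E C"
  shows "e \<epsilon> C \<Longrightarrow> e \<epsilon> E"
    and "v \<epsilon> V \<Longrightarrow> \<exists>y. pair v y \<epsilon> C"
    and "pair x y \<epsilon> C \<Longrightarrow> (\<forall>z. pair x z \<epsilon> C \<longrightarrow> z = y) \<or> (\<forall>z. pair y z \<epsilon> C \<longrightarrow> z = x)"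
proof -
  have CE: "e \<epsilon> E" if "e \<epsilon> C" for e
    using C that unfolding minimal_edge_cover_def edge_cover_def zf_subset_def by blast
  then show "e \<epsilon> C \<Longrightarrow> e \<epsilon> E" .
  have cov: "\<exists>e. e \<epsilon> C \<and> v \<epsilon> e" if "v \<epsilon> V" for v
    using C that unfolding minimal_edge_cover_def edge_cover_def by blast
  show "\<exists>y. pair v y \<epsilon> C" if v: "v \<epsilon> V" for v
  proof -
    obtain e where e: "e \<epsilon> C" "v \<epsilon> e" using cov[OF v] by blast
    obtain p q where pq: "e = pair p q" using graph_edge[OF G CE[OF e(1)]] by blast
    then have "pair p q \<epsilon> C" "pair q p \<epsilon> C" using e(1) pair_commute by metis+
    then show ?thesis using e(2) unfolding pq mem_pair by blast
  qed
  assume xy: "pair x y \<epsilon> C"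
  show "(\<forall>z. pair x z \<epsilon> C \<longrightarrow> z = y) \<or> (\<forall>z. pair y z \<epsilon> C \<longrightarrow> z = x)"
  proof (rule ccontr)
    assume "\<not> ?thesis"
    then obtain p q where p: "pair x p \<epsilon> C" "p \<noteq> y" and q: "pair y q \<epsilon> C" "q \<noteq> x" by blast
    let ?C = "sep C (\<lambda>e. e \<noteq> pair x y)"
    have mem_C: "e \<epsilon> ?C \<longleftrightarrow> e \<epsilon> C \<and> e \<noteq> pair x y" for e by (rule mem_sep) (intro definable)
    have p': "pair x p \<epsilon> ?C" and q': "pair y q \<epsilon> ?C"
      using p q unfolding mem_C pair_eq_iff by auto
    have "\<exists>e. e \<epsilon> ?C \<and> v \<epsilon> e" if v: "v \<epsilon> V" for v
    proof -
      obtain e where e: "e \<epsilon> C" "v \<epsilon> e" using cov[OF v] by blast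
      show ?thesis
      proof (cases "e = pair x y")
        case True
        then have "v = x \<or> v = y" using e by (simp add: mem_pair)
        then show ?thesis using p' q' mem_pair by metis
      next
        case False
        then show ?thesis using e mem_C by blast
      qed
    qed
    then have "edge_cover mem V E ?C"
      unfolding edge_cover_def zf_subset_def using mem_C CE by blast
    moreover have "?C \<noteq> C" using mem_C xy by metis
    ultimately show False
      using C mem_C unfolding minimal_edge_cover_def zf_subset_def by blast
  qed
qed

text \<open>
  With \<open>G A = Pw A\<close>, a minimal edge cover \<open>C\<close> consists of stars, and the diagonal set \<open>T\<close> of all
  \<open>a \<epsilon> A\<close> whose only neighbour in \<open>C\<close> is some \<open>S \<subseteq> A\<close> with \<open>a \<notin> S\<close> singles out an element of \<open>A\<close>: by
  Cantor's argument \<open>T\<close> is not the only neighbour of any \<open>a\<close>, so \<open>T\<close> has only one neighbour.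
\<close>

lemma choice_if_minimal_edge_covers:
  assumes cover: "connected_bipartite_graphs_have_minimal_edge_covers mem"
  shows "axiom_of_choice mem"
  unfolding axiom_of_choice_def
proof (intro allI impI)
  fix F assume nonempty: "\<forall>A. A \<epsilon> F \<longrightarrow> (\<exists>a. a \<epsilon> A)"
  show "\<exists>f. zf_function_on mem F f \<and> (\<forall>A a. A \<epsilon> F \<and> zf_app mem f A a \<longrightarrow> a \<epsilon> A)"
  \<comment> \<open>For empty \<open>F\<close> the graph is the hub alone, an isolated vertex
    without an edge cover.\<close>
  proof (cases "\<exists>A. A \<epsilon> F")
    case False
    have "definable (\<lambda>\<rho>. \<rho> 0 = \<rho> 1)" by (intro definable)
    then show ?thesis by (rule choice_from_relation) (use False in blast)
  next
    case True
    let ?R = "\<lambda>x y::'m. x \<noteq> x"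
    have "definable_term (\<lambda>\<rho>. Pw (\<rho> 0))" "definable (\<lambda>\<rho>. ?R (\<rho> 0) (\<rho> 1))"
      by (intro definable)+
    note hub = hub_graph_exists[where R = ?R and G = Pw and Z = "Pw (Uni F)",
        OF nonempty this(1) _ this(2)]
    obtain V E where G: "zf_graph mem V E" "zf_connected mem V E"
      and V: "\<And>v. v \<epsilon> V \<longleftrightarrow> hub_vertex F Pw v"
      and E': "\<And>x y. pair x y \<epsilon> E \<longleftrightarrow>
        x \<epsilon> V \<and> y \<epsilon> V \<and> (hub_edge F Pw x y \<or> hub_edge F Pw y x \<or> x \<noteq> x)"
      by (rule hub) (auto simp: mem_Pw mem_Uni)
    have E: "pair x y \<epsilon> E \<longleftrightarrow> x \<epsilon> V \<and> y \<epsilon> V \<and> (hub_edge F Pw x y \<or> hub_edge F Pw y x)" for x y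
      unfolding E' by blast
    have "zf_bipartite mem V E"
      by (rule hub_graph_bipartite[OF G(1) V]) (use E in blast)
    moreover have "no_isolated_vertex mem V E"
    proof -
      have "\<exists>u. pair v u \<epsilon> E" if v: "v \<epsilon> V" for v
        using v[unfolded V hub_vertex_def]
      proof (elim disjE exE conjE)
        assume "v = empt"
        obtain A a where "A \<epsilon> F" "a \<epsilon> A" using True nonempty by blast
        then have "pair v (inner A a) \<epsilon> E"
          using \<open>v = empt\<close> unfolding E V hub_vertex_def hub_edge_def by blast
        then show ?thesis by blast
      next
        fix A a assume "A \<epsilon> F" "a \<epsilon> A" "v = inner A a"
        then have "pair v empt \<epsilon> E" unfolding E V hub_vertex_def hub_edge_def by blast
        then show ?thesis by blast
      next
        fix A s assume A: "A \<epsilon> F" "s \<epsilon> Pw A" "v = outer A s"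
        obtain a where "a \<epsilon> A" using A(1) nonempty by blast
        then have "pair v (inner A a) \<epsilon> E"
          using A unfolding E V hub_vertex_def hub_edge_def by blast
        then show ?thesis by blast
      qed
      then show ?thesis unfolding no_isolated_vertex_def zf_adjacent_iff using E by blast
    qed
    ultimately obtain C where C: "minimal_edge_cover mem V E C"
      using cover G unfolding connected_bipartite_graphs_have_minimal_edge_covers_def by blast
    note CE = minimal_edge_cover_pairs(1)[OF G(1) C] and C_cov = minimal_edge_cover_pairs(2)[OF G(1) C]
      and C_min = minimal_edge_cover_pairs(3)[OF G(1) C]
    \<comment> \<open>Only inner vertices with a single edge in \<open>C\<close> take part in the
      diagonal, as only these have one set attached to them.\<close>
    let ?P = "\<lambda>A a. \<exists>S. pair (inner A a) (outer A S) \<epsilon> C \<and>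
      (\<forall>y. pair (inner A a) y \<epsilon> C \<longrightarrow> y = outer A S) \<and> \<not> a \<epsilon> S"
    define T where "T A = sep A (?P A)" for A
    have mem_T: "a \<epsilon> T A \<longleftrightarrow> a \<epsilon> A \<and> ?P A a" for a A
      unfolding T_def by (rule mem_sep) (intro definable definable_inner definable_outer)
    have "definable_term (\<lambda>\<rho>. T (\<rho> 0))"
      unfolding T_def by (intro definable definable_sep definable_inner definable_outer)
    note def_T = definable_term_app[OF this]
    show ?thesis
    proof (rule choice_from_relation)
      show "definable (\<lambda>\<rho>. pair (inner (\<rho> 0) (\<rho> 1)) (outer (\<rho> 0) (T (\<rho> 0))) \<epsilon> C)"
        by (intro definable definable_inner definable_outer def_T)
      fix A assume A: "A \<epsilon> F"
      have "outer A (T A) \<epsilon> V"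
        unfolding V hub_vertex_def mem_Pw using A mem_T by blast
      then obtain y where y: "pair (outer A (T A)) y \<epsilon> C" using C_cov by blast
      have "\<exists>a. a \<epsilon> A \<and> y = inner A a"
        using CE[OF y] unfolding E hub_edge_def by auto
      then obtain a where a: "a \<epsilon> A" "pair (inner A a) (outer A (T A)) \<epsilon> C"
        using y pair_commute by metis
      have "\<not> (\<forall>y. pair (inner A a) y \<epsilon> C \<longrightarrow> y = outer A (T A))"
      proof
        assume only: "\<forall>y. pair (inner A a) y \<epsilon> C \<longrightarrow> y = outer A (T A)"
        \<comment> \<open>The set attached to \<open>a\<close> would be \<open>T A\<close> itself,
          so membership of \<open>a\<close> in \<open>T A\<close> would mean its negation.\<close>
        have "a \<epsilon> T A \<longleftrightarrow> \<not> a \<epsilon> T A"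
        proof
          assume "a \<epsilon> T A"
          then obtain S where "pair (inner A a) (outer A S) \<epsilon> C" "\<not> a \<epsilon> S"
            unfolding mem_T by blast
          then show "\<not> a \<epsilon> T A" using only by auto
        next
          assume "\<not> a \<epsilon> T A"
          then show "a \<epsilon> T A" using a only mem_T[of a A] by blast
        qed
        then show False by blast
      qed
      \<comment> \<open>The inner end has a second edge in \<open>C\<close>, so by
        \<open>C_min\<close> the outer end has none.\<close>
      then have unique: "\<forall>z. pair (outer A (T A)) z \<epsilon> C \<longrightarrow> z = inner A a"
        using C_min[OF a(2)] by blast
      show "\<exists>!a. a \<epsilon> A \<and> pair (inner A a) (outer A (T A)) \<epsilon> C"
      proof (rule ex1I[of _ a])
        fix b assume "b \<epsilon> A \<and> pair (inner A b) (outer A (T A)) \<epsilon> C"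
        then have "pair (outer A (T A)) (inner A b) \<epsilon> C" by (simp add: pair_commute)
        then have "inner A b = inner A a" using unique by blast
        then show "b = a" by simp
      qed (use a in blast)
    qed
  qed
qed

end

theorem theorem6p4:
  fixes mem :: "'m \<Rightarrow> 'm \<Rightarrow> bool"
  assumes "ZF_model mem"
  shows "(axiom_of_choice mem \<longleftrightarrow> connected_graphs_have_minimal_dominating_sets mem) \<and>
         (axiom_of_choice mem \<longleftrightarrow> connected_bipartite_graphs_have_maximal_matchings mem) \<and>
         (axiom_of_choice mem \<longleftrightarrow> connected_bipartite_graphs_have_minimal_edge_covers mem)"
proof -
  interpret zf_universe mem by unfold_locales (rule assms)
  show ?thesis
  proof (intro conjI iffI)
    assume AC: "axiom_of_choice mem"
    show "connected_graphs_have_minimal_dominating_sets mem"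
      unfolding connected_graphs_have_minimal_dominating_sets_def
      using minimal_dominating_set_if_choice[OF AC] by blast
    show "connected_bipartite_graphs_have_maximal_matchings mem"
      unfolding connected_bipartite_graphs_have_maximal_matchings_def
      using maximal_matching_if_choice[OF AC] by blast
    show "connected_bipartite_graphs_have_minimal_edge_covers mem"
      unfolding connected_bipartite_graphs_have_minimal_edge_covers_def
      using minimal_edge_cover_if_choice[OF AC] by blast
  qed (fact choice_if_minimal_dominating_sets choice_if_maximal_matchings
    choice_if_minimal_edge_covers)+
qed

end
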